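(* Let $(X_i)_{i\ge1}$ be i.i.d. $h$-lattice valued random variables with $\mathbf{E}X_i=0$, $\mathbf{E}X_i^2=\sigma^2>0$ (with $\sigma>0$) and $\mathbf{E}|X_i|^3<\infty$, let $S_n=\sum_{i=1}^nX_i$, and let $a\in\mathbb{R}$. Then \[ \frac{1}{\log n}\sum_{k=1}^n 1_{\{S_k=a\sigma\sqrt k\}}\frac{1}{\sqrt k}\to\frac{h}{\sqrt{2\pi}\,\sigma}\,e^{-a^2/2}\quad\text{almost surely as } n\to\infty. \]
   Context: A random variable $X$ is $h$-lattice valued if $\sum_{k\in\mathbb{Z}}\mathbf{P}(X=kh+b)=1$ for some $h>0$ and $b\in\mathbb{R}$; here $h$ is assumed to be maximal with this property, and $b$ is fixed accordingly. Convention (abuse of notation): for $c\in\mathbb{R}$, the event "$S_n=c\sqrt n$" means $S_n=\left[(c\sqrt n-nb)/h\right]h+nb$, where $[\cdot]$ denotes the integer part; here it is used with $c=a\sigma$. $1_E$ is the indicator function of the event $E$. *)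

theory Defs
  imports "HOL-Probability.Probability"
begin

definition lattice_supported :: "'a measure \<Rightarrow> ('a \<Rightarrow> real) \<Rightarrow> real \<Rightarrow> real \<Rightarrow> bool" where
  "lattice_supported M X h b \<longleftrightarrow>
     h > 0 \<and>
     ((\<lambda>k::int. measure M {\<omega> \<in> space M. X \<omega> = of_int k * h + b}) has_sum 1) UNIV"

(* The span h is maximal over all lattices carrying X, whatever their offset. *)
definition lattice_valued :: "'a measure \<Rightarrow> ('a \<Rightarrow> real) \<Rightarrow> real \<Rightarrow> real \<Rightarrow> bool" where
  "lattice_valued M X h b \<longleftrightarrow>
     lattice_supported M X h b \<and> (\<forall>h' b'. lattice_supported M X h' b' \<longrightarrow> h' \<le> h)"

(* The point of the lattice n b + h Z that stands for c sqrt n in the event "S_n = c sqrt n".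
   The integer part is the floor: the point is then the largest lattice point not exceeding
   c sqrt n, and does not depend on the choice of b modulo h. *)
definition lattice_round :: "real \<Rightarrow> real \<Rightarrow> nat \<Rightarrow> real \<Rightarrow> real" where
  "lattice_round h b n c = of_int \<lfloor>(c * sqrt (real n) - real n * b) / h\<rfloor> * h + real n * b"

definition partial_sum :: "(nat \<Rightarrow> 'a \<Rightarrow> real) \<Rightarrow> nat \<Rightarrow> 'a \<Rightarrow> real" where
  "partial_sum X n \<omega> = (\<Sum>i=1..n. X i \<omega>)"

end

theory Submission
  imports Defs "HOL-Real_Asymp.Real_Asymp"
begin

text \<open>
  The sum of the weights over the hits up to time \<open>n\<close> is nondecreasing in \<open>n\<close>, so Chebyshev's
  inequality along the times \<open>exp (i\<^sup>2)\<close> gives almost sure convergence as soon as its mean is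
  asymptotic to a multiple of \<open>ln n\<close> and its variance is \<open>O(ln n)\<close>. The mean is given by the local
  limit theorem. Writing \<open>l\<^sub>k\<close> for the lattice point aimed at in step \<open>k\<close>, the covariance of the hits
  at times \<open>j < k\<close> is
  \<open>P(S\<^sub>j = l\<^sub>j) * (P(S\<^sub>k - S\<^sub>j = l\<^sub>k - l\<^sub>j) - P(S\<^sub>k = l\<^sub>k))\<close>. By Fourier inversion on the lattice, the
  second factor is the integral over \<open>\<bar>t\<bar> \<le> pi / h\<close> of a function bounded by
  \<open>\<bar>\<phi> t\<bar> ^ (k - j) * \<bar>iexp (t * l\<^sub>j) - \<phi> t ^ j\<bar>\<close>. Here \<open>\<bar>\<phi> t\<bar> \<le> exp (- c t\<^sup>2)\<close> because \<open>h\<close> is the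
  maximal span, and \<open>\<bar>iexp (t * l\<^sub>j) - \<phi> t ^ j\<bar> = O(\<bar>t\<bar> sqrt j)\<close>, so the factor is
  \<open>O(sqrt j / (k - j))\<close>; it is also at most \<open>O(1 / sqrt (k - j))\<close>.
\<close>

section \<open>Logarithmic averages\<close>

lemma harm_le_ln: "n \<ge> 1 \<Longrightarrow> harm n \<le> ln (real n) + 1"
  using euler_mascheroni_sequence_decreasing[of 1 n] by (simp add: harm_expand)

text \<open>Toeplitz averaging: the weights \<open>1 / k\<close> add up to \<open>harm n\<close>,
  which is \<open>ln n\<close> up to a bounded error. Finitely many early terms are negligible
  against \<open>ln n\<close>, and the later ones deviate from \<open>L\<close> by less than
  \<open>e / 4\<close>.\<close>

lemma log_average_tendsto:
  fixes c :: "nat \<Rightarrow> real"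
  assumes "c \<longlonglongrightarrow> L"
  shows "(\<lambda>n. (\<Sum>k=1..n. c k / real k) / ln (real n)) \<longlonglongrightarrow> L"
proof (rule LIMSEQ_I)
  fix e :: real assume e: "e > 0"
  obtain N where N: "\<And>k. k \<ge> N \<Longrightarrow> \<bar>c k - L\<bar> < e / 4"
    using LIMSEQ_D[OF assms, of "e/4"] e by auto
  define K where "K = (\<Sum>k=1..N. \<bar>c k - L\<bar> / real k)"
  have K0: "K \<ge> 0" by (auto simp: K_def intro!: sum_nonneg)
  \<comment> \<open>\<open>K\<close> bounds the terms up to \<open>N\<close>,
    \<open>\<bar>L\<bar>\<close> pays for replacing \<open>harm n\<close> by \<open>ln n\<close>,
    and the constant \<open>e / 4\<close> for the \<open>+ 1\<close> in
    \<open>harm_le_ln\<close>.\<close>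
  have diff: "\<bar>(\<Sum>k=1..n. c k / real k) - L * ln n\<bar> \<le> (K + \<bar>L\<bar> + e / 4) + e / 4 * ln n" if n: "n \<ge> 1" for n
  proof -
    have "\<bar>(\<Sum>k=1..n. c k / real k) - L * harm n\<bar> = \<bar>\<Sum>k=1..n. (c k - L) / real k\<bar>"
      by (simp add: harm_def sum_distrib_left left_diff_distrib sum_subtractf divide_inverse)
    also have "\<dots> \<le> (\<Sum>k=1..n. \<bar>c k - L\<bar> / real k)"
      by (rule order_trans[OF sum_abs]) simp
    also have "\<dots> \<le> (\<Sum>k=1..n. (if k \<le> N then \<bar>c k - L\<bar> / real k else 0) + e / 4 * inverse (real k))"
    proof (rule sum_mono)
      fix k
      have "\<bar>c k - L\<bar> / real k \<le> e / 4 * inverse (real k)" if "\<not> k \<le> N"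
        unfolding divide_inverse[of _ "real k"] using N[of k] that by (intro mult_right_mono) auto
      moreover have "0 \<le> e / 4 * inverse (real k)" using e by simp
      ultimately show "\<bar>c k - L\<bar> / real k \<le> (if k \<le> N then \<bar>c k - L\<bar> / real k else 0) + e / 4 * inverse (real k)"
        by (cases "k \<le> N") auto
    qed
    also have "\<dots> = (\<Sum>k\<in>{1..n}. if k \<le> N then \<bar>c k - L\<bar> / real k else 0) + e / 4 * harm n"
      by (simp add: sum.distrib harm_def sum_distrib_left)
    also have "(\<Sum>k\<in>{1..n}. if k \<le> N then \<bar>c k - L\<bar> / real k else 0)
               = (\<Sum>k\<in>{1..n} \<inter> {..N}. \<bar>c k - L\<bar> / real k)"
      by (subst sum.inter_restrict) auto
    also have "\<dots> \<le> K"
      unfolding K_def by (rule sum_mono2) auto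
    also have "harm n \<le> ln (real n) + 1" using harm_le_ln[OF n] .
    finally have 1: "\<bar>(\<Sum>k=1..n. c k / real k) - L * harm n\<bar> \<le> K + e / 4 * (ln n + 1)" using e by simp
    have "\<bar>harm n - ln (real n)\<bar> \<le> 1"
      using harm_le_ln[OF n] euler_mascheroni_sequence_nonneg[of n] n by auto
    then have "\<bar>L * harm n - L * ln n\<bar> \<le> \<bar>L\<bar>"
      by (metis abs_ge_zero abs_mult mult.right_neutral mult_left_mono right_diff_distrib)
    then show ?thesis using 1 unfolding distrib_left by linarith
  qed
  have "(\<lambda>n. (K + \<bar>L\<bar> + e / 4) / ln (real n)) \<longlonglongrightarrow> 0" by real_asymp
  from LIMSEQ_D[OF this, of "e/4"] e obtain N2 where
    N2: "\<And>n. n \<ge> N2 \<Longrightarrow> \<bar>(K + \<bar>L\<bar> + e / 4) / ln (real n)\<bar> < e / 4" by auto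
  show "\<exists>no. \<forall>n\<ge>no. norm ((\<Sum>k=1..n. c k / real k) / ln (real n) - L) < e"
  proof (intro exI[of _ "max N2 2"] allI impI)
    fix n assume n: "n \<ge> max N2 2"
    then have ln: "ln (real n) > 0" by simp
    have "\<bar>(\<Sum>k=1..n. c k / real k) / ln (real n) - L\<bar> = \<bar>(\<Sum>k=1..n. c k / real k) - L * ln n\<bar> / ln n"
      using ln by (simp add: field_simps abs_if)
    also have "\<dots> \<le> ((K + \<bar>L\<bar> + e / 4) + e / 4 * ln n) / ln n"
      using diff[of n] n ln by (intro divide_right_mono) auto
    also have "\<dots> = (K + \<bar>L\<bar> + e / 4) / ln n + e / 4"
      using ln by (simp add: add_divide_distrib)
    also have "\<dots> < e"
    proof -
      have "(K + \<bar>L\<bar> + e / 4) / ln n < e / 4" using abs_less_iff N2[of n] n by (meson max.boundedE)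
      then show ?thesis using e by linarith
    qed
    finally show "norm ((\<Sum>k=1..n. c k / real k) / ln (real n) - L) < e" by simp
  qed
qed

text \<open>Monotonicity fills the gaps between the times \<open>N i\<close>:
  \<open>ln (N i)\<close> is asymptotic to \<open>i\<^sup>2\<close>, and
  \<open>(i + 1)\<^sup>2 / i\<^sup>2\<close> tends to 1, so the two neighbouring values of the
  subsequence sandwich \<open>f n / ln n\<close>.\<close>

lemma mono_log_ratio_tendsto:
  fixes f :: "nat \<Rightarrow> real"
  defines "N i \<equiv> nat \<lceil>exp (real i ^ 2)\<rceil>"
  assumes mono: "mono f" and nn: "\<And>n. f n \<ge> 0"
    and lim: "(\<lambda>i. f (N i) / ln (real (N i))) \<longlonglongrightarrow> L"
  shows "(\<lambda>n. f n / ln (real n)) \<longlonglongrightarrow> L"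
proof -
  \<comment> \<open>The index of the gap containing \<open>n\<close>: for \<open>n \<ge> 1\<close>,
    \<open>exp (j\<^sup>2) \<le> n < exp ((j + 1)\<^sup>2)\<close>. As \<open>n\<close> is an
    integer, rounding up the lower end still leaves \<open>N (j n) \<le> n\<close>.\<close>
  define j where "j n = nat \<lfloor>sqrt (ln (real n))\<rfloor>" for n :: nat
  have "(\<lambda>i. ln (real (N i)) / real i ^ 2) \<longlonglongrightarrow> 1" unfolding N_def by real_asymp
  from tendsto_mult[OF lim this]
  have "(\<lambda>i. f (N i) / ln (real (N i)) * (ln (real (N i)) / real i ^ 2)) \<longlonglongrightarrow> L" by simp
  moreover have "\<forall>\<^sub>F i in sequentially. f (N i) / ln (real (N i)) * (ln (real (N i)) / real i ^ 2) = f (N i) / real i ^ 2"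
  proof -
    have "\<forall>\<^sub>F i in sequentially. ln (real (N i)) > 0" unfolding N_def by real_asymp
    then show ?thesis by eventually_elim auto
  qed
  ultimately have g: "(\<lambda>i. f (N i) / real i ^ 2) \<longlonglongrightarrow> L" by (rule Lim_transform_eventually)
  have lower: "(\<lambda>i. f (N i) / real i ^ 2 * (real i ^ 2 / (real i + 1) ^ 2)) \<longlonglongrightarrow> L * 1"
    by (rule tendsto_mult[OF g]) real_asymp
  have upper: "(\<lambda>i. f (N (Suc i)) / real (Suc i) ^ 2 * ((real i + 1) ^ 2 / real i ^ 2)) \<longlonglongrightarrow> L * 1"
    by (rule tendsto_mult[OF LIMSEQ_Suc[OF g]]) real_asymp
  have jt: "filterlim j sequentially sequentially" unfolding j_def by real_asymp
  have ev: "\<forall>\<^sub>F n in sequentially. j n \<ge> 1" using jt by (auto simp: filterlim_at_top)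
  have key: "real (j n) ^ 2 \<le> ln n \<and> ln n < (real (j n) + 1) ^ 2 \<and> N (j n) \<le> n \<and> n \<le> N (Suc (j n))"
    if "j n \<ge> 1" for n
  proof -
    have n1: "n \<ge> 1" using that by (cases n) (auto simp: j_def)
    then have l0: "ln (real n) \<ge> 0" by simp
    have j1: "real (j n) \<le> sqrt (ln n)" "sqrt (ln n) < real (j n) + 1"
      using l0 unfolding j_def by (auto simp: of_nat_nat)
    have a: "real (j n) ^ 2 \<le> ln n"
      using power_mono[OF j1(1), of 2] l0 by simp
    have b: "ln n < (real (j n) + 1) ^ 2"
      using power_strict_mono[OF j1(2), of 2] l0 by simp
    have "exp (real (j n) ^ 2) \<le> real n"
      using a n1 by (metis exp_le_cancel_iff exp_ln of_nat_0_less_iff less_eq_Suc_le One_nat_def)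
    moreover have "real n \<le> exp ((real (j n) + 1) ^ 2)"
      using b n1 by (metis exp_le_cancel_iff exp_ln of_nat_0_less_iff less_eq_Suc_le One_nat_def less_imp_le)
    ultimately show ?thesis using a b unfolding N_def
      by (auto simp: nat_le_iff ceiling_le_iff add.commute le_nat_iff) linarith
  qed
  show ?thesis
  proof (rule tendsto_sandwich)
    show "(\<lambda>n. f (N (j n)) / real (j n) ^ 2 * (real (j n) ^ 2 / (real (j n) + 1) ^ 2)) \<longlonglongrightarrow> L"
      using filterlim_compose[OF lower jt] by simp
    show "(\<lambda>n. f (N (Suc (j n))) / real (Suc (j n)) ^ 2 * ((real (j n) + 1) ^ 2 / real (j n) ^ 2)) \<longlonglongrightarrow> L"
      using filterlim_compose[OF upper jt] by simp
    show "\<forall>\<^sub>F n in sequentially. f (N (j n)) / real (j n) ^ 2 * (real (j n) ^ 2 / (real (j n) + 1) ^ 2) \<le> f n / ln (real n)"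
      using ev
    proof eventually_elim
      case (elim n)
      note k = key[OF elim]
      have "0 < real (j n) ^ 2" using elim by simp
      then have l0: "0 < ln n" using k by linarith
      have "f (N (j n)) / real (j n) ^ 2 * (real (j n) ^ 2 / (real (j n) + 1) ^ 2) = f (N (j n)) / (real (j n) + 1) ^ 2"
        using elim by simp
      also have "\<dots> \<le> f n / ln n"
        using k nn monoD[OF mono] l0 by (intro frac_le) auto
      finally show ?case .
    qed
    show "\<forall>\<^sub>F n in sequentially. f n / ln (real n) \<le> f (N (Suc (j n))) / real (Suc (j n)) ^ 2 * ((real (j n) + 1) ^ 2 / real (j n) ^ 2)"
      using ev
    proof eventually_elim
      case (elim n)
      note k = key[OF elim]
      have "0 < real (j n) ^ 2" using elim by simp
      then have "f n / ln n \<le> f (N (Suc (j n))) / real (j n) ^ 2"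
        using k nn monoD[OF mono] by (intro frac_le) auto
      also have "\<dots> = f (N (Suc (j n))) / real (Suc (j n)) ^ 2 * ((real (j n) + 1) ^ 2 / real (j n) ^ 2)"
        by (simp add: add.commute)
      finally show ?case .
    qed
  qed
qed

section \<open>Elementary sums behind the variance bound\<close>

lemma sum_inverse_sqrt_le: "(\<Sum>m=1..n. 1 / sqrt (real m)) \<le> 2 * sqrt (real n)"
proof (induction n)
  case (Suc n)
  define x y where "x = sqrt (real n)" and "y = sqrt (real (Suc n))"
  have xy: "x \<ge> 0" "y > 0" "y^2 = x^2 + 1" unfolding x_def y_def by auto
  \<comment> \<open>With \<open>y\<^sup>2 = x\<^sup>2 + 1\<close> this square becomes the
    telescoping bound \<open>1 / y \<le> 2 * y - 2 * x\<close>.\<close>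
  have "0 \<le> (y - x)^2" by simp
  then have "1 \<le> 2 * y * (y - x)" using xy by (simp add: power2_eq_square algebra_simps)
  then have "2 * x + 1 / y \<le> 2 * y" using xy by (simp add: field_simps)
  then show ?case using Suc unfolding x_def y_def by (simp del: of_nat_Suc)
qed simp

text \<open>Each term is at most a difference of consecutive values of \<open>2 / sqrt m\<close>.
  Keeping the negative term \<open>- 2 / sqrt n\<close> is what makes the induction
  telescope.\<close>

lemma sum_inverse_three_halves_le:
  assumes "j \<ge> 1" "j \<le> n"
  shows "(\<Sum>m=Suc j..n. 1 / (real m * sqrt (real m))) \<le> 2 / sqrt (real j) - 2 / sqrt (real n)"
  using assms(2)
proof (induction n rule: dec_induct)
  case (step n)
  define x y where "x = sqrt (real n)" and "y = sqrt (real (Suc n))"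
  have xy: "x > 0" "y > 0" "y^2 = x^2 + 1" "x \<le> y" using step assms unfolding x_def y_def by auto
  \<comment> \<open>Uses \<open>(y - x) * (y + x) = 1\<close>; enlarging \<open>x\<close> to
    \<open>y\<close> gives the sign of the numerator below.\<close>
  have "x * 1 = x * (y - x) * (y + x)" using xy by (simp add: power2_eq_square algebra_simps)
  also have "\<dots> \<le> y * (y - x) * (y + y)" using xy by (intro mult_mono) auto
  finally have "x \<le> 2 * y^2 * (y - x)" by (simp add: power2_eq_square algebra_simps)
  moreover have "2 / x - 2 / y - 1 / (y^2 * y) = (2 * y^2 * (y - x) - x) / (x * y^2 * y)"
    using xy(1,2) by (simp add: field_simps power2_eq_square)
  ultimately have "0 \<le> 2 / x - 2 / y - 1 / (y^2 * y)" using xy by simp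
  then have "1 / (y^2 * y) \<le> 2 / x - 2 / y" by simp
  moreover have "y^2 = real (Suc n)" by (simp add: y_def)
  ultimately have "1 / (real (Suc n) * sqrt (real (Suc n))) \<le> 2 / sqrt (real n) - 2 / sqrt (real (Suc n))"
    unfolding x_def y_def by simp
  moreover have "(\<Sum>m=Suc j..Suc n. 1 / (real m * sqrt (real m))) =
      (\<Sum>m=Suc j..n. 1 / (real m * sqrt (real m))) + 1 / (real (Suc n) * sqrt (real (Suc n)))"
    using step by (subst sum.nat_ivl_Suc') (auto simp del: of_nat_Suc)
  ultimately show ?case using step.IH by linarith
qed simp

text \<open>The summand is, up to a factor depending on \<open>j\<close>, the covariance bound at
  gap \<open>m\<close> times the weight at time \<open>j + m\<close>. Splitting at
  \<open>m = j\<close>, the first branch of the minimum with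
  \<open>sqrt (j + m) \<ge> sqrt j\<close> gives 2, and the second with
  \<open>sqrt (j + m) \<ge> sqrt m\<close> gives another 2.\<close>

lemma sum_covariance_kernel_le:
  assumes j: "j \<ge> 1"
  shows "(\<Sum>m=1..n. 1 / sqrt (real (j + m)) * min (1 / sqrt (real m)) (sqrt (real j) / real m)) \<le> 4"
proof -
  have sj: "sqrt (real j) > 0" using j by simp
  have "(\<Sum>m=1..n. 1 / sqrt (real (j + m)) * min (1 / sqrt (real m)) (sqrt (real j) / real m))
      \<le> (\<Sum>m\<in>{1..j} \<union> {Suc j..max j n}. 1 / sqrt (real (j + m)) * min (1 / sqrt (real m)) (sqrt (real j) / real m))"
    by (rule sum_mono2) auto
  also have "\<dots> = (\<Sum>m\<in>{1..j}. 1 / sqrt (real (j + m)) * min (1 / sqrt (real m)) (sqrt (real j) / real m))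
     + (\<Sum>m\<in>{Suc j..max j n}. 1 / sqrt (real (j + m)) * min (1 / sqrt (real m)) (sqrt (real j) / real m))"
    by (rule sum.union_disjoint) auto
  also have "\<dots> \<le> (\<Sum>m\<in>{1..j}. 1 / sqrt (real j) * (1 / sqrt (real m)))
     + (\<Sum>m\<in>{Suc j..max j n}. sqrt (real j) * (1 / (real m * sqrt (real m))))"
  proof (intro add_mono sum_mono)
    fix m assume "m \<in> {1..j}"
    then show "1 / sqrt (real (j + m)) * min (1 / sqrt (real m)) (sqrt (real j) / real m) \<le> 1 / sqrt (real j) * (1 / sqrt (real m))"
      using j by (intro mult_mono frac_le) auto
  next
    fix m assume "m \<in> {Suc j..max j n}"
    then have "1 / sqrt (real (j + m)) * min (1 / sqrt (real m)) (sqrt (real j) / real m) \<le> 1 / sqrt (real m) * (sqrt (real j) / real m)"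
      using j by (intro mult_mono frac_le) auto
    then show "1 / sqrt (real (j + m)) * min (1 / sqrt (real m)) (sqrt (real j) / real m) \<le> sqrt (real j) * (1 / (real m * sqrt (real m)))"
      by (simp add: mult.commute)
  qed
  also have "\<dots> \<le> 1 / sqrt (real j) * (2 * sqrt (real j)) + sqrt (real j) * (2 / sqrt (real j))"
    unfolding sum_distrib_left[symmetric]
  proof (intro add_mono mult_left_mono)
    have "2 / sqrt (real (max j n)) \<ge> 0" by simp
    then show "(\<Sum>m = Suc j..max j n. 1 / (real m * sqrt (real m))) \<le> 2 / sqrt (real j)"
      using sum_inverse_three_halves_le[OF j, of "max j n"] by linarith
  qed (use sum_inverse_sqrt_le sj in auto)
  also have "\<dots> = 4" using sj by simp
  finally show ?thesis .
qed

lemma sum_symmetric_square: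
  fixes f :: "nat \<Rightarrow> nat \<Rightarrow> real"
  assumes "\<And>j k. f j k = f k j"
  shows "(\<Sum>j=1..n. \<Sum>k=1..n. f j k) = (\<Sum>j=1..n. f j j + 2 * (\<Sum>m=1..n-j. f j (j + m)))"
proof (induction n)
  case (Suc n)
  have *: "(\<Sum>m=1..Suc n-j. f j (j + m)) = (\<Sum>m=1..n-j. f j (j + m)) + f j (Suc n)" if "j \<in> {1..n}" for j
    using that by (auto simp: Suc_diff_le)
  have "(\<Sum>j=1..Suc n. f j j + 2 * (\<Sum>m=1..Suc n-j. f j (j + m)))
     = f (Suc n) (Suc n) + (\<Sum>j=1..n. f j j + 2 * ((\<Sum>m=1..n-j. f j (j + m)) + f j (Suc n)))"
    using * by simp
  also have "\<dots> = f (Suc n) (Suc n) + (\<Sum>j=1..n. \<Sum>k=1..n. f j k) + 2 * (\<Sum>j=1..n. f j (Suc n))"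
    unfolding Suc by (simp add: sum.distrib sum_distrib_left algebra_simps)
  also have "\<dots> = (\<Sum>j=1..Suc n. \<Sum>k=1..Suc n. f j k)"
    using assms by (simp add: sum.distrib)
  finally show ?case by simp
qed simp

text \<open>The normalised squared deviations along the times \<open>N i\<close> have expectations
  of order \<open>1 / i\<^sup>2\<close>. Their series therefore has finite expectation, converges
  almost surely, and its terms tend to 0; monotonicity extends this to all \<open>n\<close>.\<close>

lemma (in prob_space) AE_log_law:
  fixes T :: "nat \<Rightarrow> 'a \<Rightarrow> real"
  assumes [measurable]: "\<And>n. T n \<in> borel_measurable M"
    and sq: "\<And>n. integrable M (\<lambda>\<omega>. (T n \<omega>)\<^sup>2)"
    and nn: "\<And>n \<omega>. T n \<omega> \<ge> 0"
    and mono: "\<And>\<omega>. mono (\<lambda>n. T n \<omega>)"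
    and mean: "(\<lambda>n. expectation (T n) / ln (real n)) \<longlonglongrightarrow> L"
    and var: "\<And>n. n \<ge> 1 \<Longrightarrow> variance (T n) \<le> K * (ln (real n) + 1)"
  shows "AE \<omega> in M. (\<lambda>n. T n \<omega> / ln (real n)) \<longlonglongrightarrow> L"
proof -
  define N where "N i = nat \<lceil>exp (real i ^ 2)\<rceil>" for i :: nat
  define Z where "Z i \<omega> = (T (N i) \<omega> - expectation (T (N i)))\<^sup>2 / (ln (real (N i)))\<^sup>2" for i \<omega>
  have int: "integrable M (T n)" for n
    by (rule square_integrable_imp_integrable[OF _ sq]) simp
  have intZ: "integrable M (Z i)" for i
    unfolding Z_def using int sq[of "N i"]
    by (intro integrable_divide) (auto simp: power2_diff)
  have Nt: "filterlim N sequentially sequentially" unfolding N_def by real_asymp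
  have N1: "N i \<ge> 1" for i
  proof -
    have "(0::real) < exp (real i ^ 2)" by simp
    then have "\<lceil>exp (real i ^ 2)\<rceil> \<ge> 1" by linarith
    then show ?thesis unfolding N_def by linarith
  qed
  \<comment> \<open>At \<open>n = 1\<close> the logarithm vanishes and the variance bound is
    \<open>K\<close> itself.\<close>
  have K0: "K \<ge> 0" using order_trans[OF variance_positive[of "T 1"] var[of 1]] by simp
  have Zb: "expectation (Z i) \<le> 2 * K / real i ^ 2" if "i \<ge> 1" for i
  proof -
    have "exp (real i ^ 2) \<le> real (N i)" unfolding N_def by linarith
    then have l: "real i ^ 2 \<le> ln (N i)" using N1[of i] by (subst ln_ge_iff) auto
    have "1 \<le> real i ^ 2" using that by simp
    then have l1: "1 \<le> ln (N i)" using l by linarith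
    have "expectation (Z i) = variance (T (N i)) / (ln (N i))\<^sup>2"
      unfolding Z_def by simp
    also have "\<dots> \<le> K * (ln (N i) + 1) / (ln (N i))\<^sup>2"
      using var[OF N1[of i]] by (intro divide_right_mono) auto
    \<comment> \<open>For \<open>i \<ge> 1\<close> the logarithm is at least 1 and absorbs the
      \<open>+ 1\<close>, hence the factor 2.\<close>
    also have "\<dots> \<le> K * (2 * ln (N i)) / (ln (N i))\<^sup>2"
      using l1 K0 by (intro divide_right_mono mult_left_mono) auto
    also have "\<dots> = 2 * K / ln (N i)" using l1 by (simp add: power2_eq_square)
    also have "\<dots> \<le> 2 * K / real i ^ 2" using l l1 K0 that by (intro divide_left_mono mult_pos_pos) auto
    finally show ?thesis .
  qed
  have "summable (\<lambda>i. expectation (Z i))"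
  proof (rule summable_comparison_test')
    show "summable (\<lambda>i. 2 * K * (1 / real i ^ 2))"
      using inverse_power_summable[of 2, where 'a = real] by (intro summable_mult) (auto simp: divide_inverse)
    fix i :: nat assume "i \<ge> 1"
    moreover have "expectation (Z i) \<ge> 0" by (intro integral_nonneg_AE) (auto simp: Z_def)
    ultimately show "norm (expectation (Z i)) \<le> 2 * K * (1 / real i ^ 2)" using Zb[of i] by simp
  qed
  then have "(\<Sum>i. ennreal (expectation (Z i))) \<noteq> \<infinity>"
    by (subst suminf_ennreal2) (auto intro!: integral_nonneg_AE simp: Z_def)
  moreover have "(\<Sum>i. ennreal (expectation (Z i))) = (\<Sum>i. \<integral>\<^sup>+\<omega>. ennreal (Z i \<omega>) \<partial>M)"
    using intZ by (intro suminf_cong nn_integral_eq_integral[symmetric]) (auto simp: Z_def)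
  moreover have "\<dots> = (\<integral>\<^sup>+\<omega>. (\<Sum>i. ennreal (Z i \<omega>)) \<partial>M)"
    by (rule nn_integral_suminf[symmetric]) (auto simp: Z_def)
  ultimately have "AE \<omega> in M. (\<Sum>i. ennreal (Z i \<omega>)) \<noteq> \<infinity>"
    by (intro nn_integral_noteq_infinite) (auto simp: Z_def)
  then show ?thesis
  proof eventually_elim
    case (elim \<omega>)
    then have "summable (\<lambda>i. Z i \<omega>)"
      by (intro summable_suminf_not_top) (auto simp: Z_def)
    then have "(\<lambda>i. sqrt (Z i \<omega>)) \<longlonglongrightarrow> 0"
      using tendsto_real_sqrt[OF summable_LIMSEQ_zero] by fastforce
    moreover have "sqrt (Z i \<omega>) = \<bar>(T (N i) \<omega> - expectation (T (N i))) / ln (real (N i))\<bar>" for i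
      unfolding Z_def power_divide[symmetric] by simp
    ultimately have "(\<lambda>i. (T (N i) \<omega> - expectation (T (N i))) / ln (real (N i))) \<longlonglongrightarrow> 0"
      by (simp only: tendsto_rabs_zero_iff)
    from tendsto_add[OF this filterlim_compose[OF mean Nt]]
    have "(\<lambda>i. T (N i) \<omega> / ln (real (N i))) \<longlonglongrightarrow> L" by (simp add: diff_divide_distrib)
    then show ?case
      unfolding N_def by (intro mono_log_ratio_tendsto mono nn)
  qed
qed

section \<open>Characteristic functions of lattice variables\<close>

text \<open>Since \<open>h > 0\<close>, the events for different \<open>k\<close> are disjoint, so
  the sum in the definition is the probability of their union.\<close>

lemma (in prob_space) lattice_supported_iff:
  assumes [measurable]: "Y \<in> borel_measurable M"
  shows "lattice_supported M Y h b \<longleftrightarrow> h > 0 \<and> (AE \<omega> in M. \<exists>k::int. Y \<omega> = of_int k * h + b)"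
proof (cases "h > 0")
  case True
  define A where "A k = {\<omega> \<in> space M. Y \<omega> = of_int k * h + b}" for k :: int
  have [measurable]: "A k \<in> events" for k unfolding A_def by measurable
  have disj: "disjoint_family A"
    using True by (auto simp: disjoint_family_on_def A_def)
  have "((\<lambda>k. prob (A k)) has_sum prob (\<Union>k. A k)) UNIV"
  proof -
    \<comment> \<open>Countable additivity is indexed by naturals; \<open>int_decode\<close>
      transfers it to the integers.\<close>
    have "disjoint_family (\<lambda>n. A (int_decode n))"
      using disj inj_int_decode by (auto simp: disjoint_family_on_def inj_eq)
    then have "(\<lambda>n. prob (A (int_decode n))) sums prob (\<Union>n. A (int_decode n))"
      by (intro finite_measure_UNION) auto
    then have "((\<lambda>n. prob (A (int_decode n))) has_sum prob (\<Union>n. A (int_decode n))) UNIV"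
      by (intro sums_nonneg_imp_has_sum) auto
    moreover have "(\<Union>n. A (int_decode n)) = (\<Union>k. A k)"
      using surj_int_decode by (auto simp: surj_def) metis
    ultimately show ?thesis
      using has_sum_reindex_bij_betw[OF bij_int_decode, of "\<lambda>k. prob (A k)"] by simp
  qed
  then have "lattice_supported M Y h b \<longleftrightarrow> prob (\<Union>k. A k) = 1"
    using True unfolding lattice_supported_def A_def[symmetric] by (metis has_sum_unique)
  also have "\<dots> \<longleftrightarrow> (AE \<omega> in M. \<exists>k::int. Y \<omega> = of_int k * h + b)"
    by (subst prob_eq_1) (auto simp: A_def intro!: AE_cong)
  finally show ?thesis using True by simp
qed (simp add: lattice_supported_def)

text \<open>Orthogonality of characters over one period: for \<open>k \<noteq> 0\<close> the
  antiderivative takes equal values at both ends, whose phases \<open>k * pi\<close> and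
  \<open>- k * pi\<close> differ by a multiple of \<open>2 * pi\<close>.\<close>

lemma integral_iexp_multiple:
  fixes h :: real and k :: int
  assumes "h > 0"
  shows "(CLBINT t:{-pi/h..pi/h}. iexp (t * (of_int k * h))) = (if k = 0 then 2 * pi / h else 0)"
proof (cases "k = 0")
  case True
  have "(CLBINT t:{-pi/h..pi/h}. 1) = complex_of_real (measure lborel {-pi/h..pi/h})"
    unfolding set_lebesgue_integral_def using assms
    by (subst integral_scaleR_left) (auto simp: scaleR_conv_of_real intro!: integrable_real_indicator)
  then show ?thesis using True assms by simp
next
  case False
  define y where "y = of_int k * h"
  have y: "y \<noteq> 0" using False assms by (simp add: y_def)
  have "(CLBINT t:{-pi/h..pi/h}. iexp (t * y)) = (CLBINT t=-pi/h..pi/h. iexp (t * y))"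
    using assms by (subst interval_integral_Icc) (auto simp: divide_right_mono)
  also have "\<dots> = - \<i> / y * iexp (pi / h * y) - - \<i> / y * iexp (- pi / h * y)"
    using y by (intro interval_integral_FTC_finite)
       (auto intro!: derivative_eq_intros continuous_intros simp: has_vector_derivative_complex_iff Re_exp Im_exp)
  also have "iexp (pi / h * y) = iexp (- pi / h * y)"
  proof -
    have "iexp (pi / h * y) = exp (\<i> * (of_int k * pi))" "iexp (- pi / h * y) = exp (\<i> * (- of_int k * pi))"
      using assms by (simp_all add: y_def mult.commute)
    moreover have "sin (of_int k * pi) = 0" by (simp add: sin_times_pi_eq_0)
    ultimately show ?thesis by (simp add: complex_eq_iff Re_exp Im_exp)
  qed
  finally show ?thesis using False by (simp add: y_def)
qed

text \<open>The point \<open>x\<close> lies on the lattice carrying \<open>Y\<close>. After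
  exchanging the integrals by Fubini, orthogonality turns the inner one into
  \<open>2 * pi / h\<close> times the indicator of \<open>Y = x\<close>.\<close>

lemma (in prob_space) lattice_inversion:
  fixes Y :: "'a \<Rightarrow> real"
  assumes [measurable]: "Y \<in> borel_measurable M" and h: "h > 0"
    and lat: "AE \<omega> in M. \<exists>k::int. Y \<omega> = of_int k * h + x"
  shows "complex_of_real (prob {\<omega> \<in> space M. Y \<omega> = x}) =
    h / (2 * pi) * (CLBINT t:{-pi/h..pi/h}. char (distr M borel Y) t * iexp (- (t * x)))"
proof -
  interpret P: pair_sigma_finite lborel M ..
  let ?I = "{-pi/h..pi/h}"
  let ?f = "\<lambda>t \<omega>. indicator ?I t *\<^sub>R iexp (t * (Y \<omega> - x))"
  have int: "integrable (lborel \<Otimes>\<^sub>M M) (case_prod ?f)"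
  proof (rule integrableI_bounded_set[where A="?I \<times> space M" and B=1])
    show "emeasure (lborel \<Otimes>\<^sub>M M) (?I \<times> space M) < \<infinity>"
      using h by (subst emeasure_pair_measure_Times) (auto simp: emeasure_space_1 ennreal_mult_less_top)
    show "AE z in lborel \<Otimes>\<^sub>M M. z \<notin> ?I \<times> space M \<longrightarrow> case_prod ?f z = 0"
      by (rule AE_I2) (auto simp: space_pair_measure indicator_def)
  qed (auto simp: indicator_def)
  have "h / (2 * pi) * (CLBINT t:?I. char (distr M borel Y) t * iexp (- (t * x)))
      = h / (2 * pi) * (CLBINT t. (CLINT \<omega>|M. ?f t \<omega>))"
    unfolding set_lebesgue_integral_def
  proof (intro arg_cong[where f="\<lambda>z. _ * z"] Bochner_Integration.integral_cong refl)
    fix t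
    have "char (distr M borel Y) t * iexp (- (t * x)) = (CLINT \<omega>|M. iexp (t * Y \<omega>) * iexp (- (t * x)))"
      by (simp add: char_def integral_distr)
    also have "\<dots> = (CLINT \<omega>|M. iexp (t * (Y \<omega> - x)))"
      by (simp add: exp_add[symmetric] algebra_simps)
    finally show "indicat_real ?I t *\<^sub>R (char (distr M borel Y) t * iexp (- (t * x))) = (CLINT \<omega>|M. ?f t \<omega>)"
      by simp
  qed
  also have "(CLBINT t. (CLINT \<omega>|M. ?f t \<omega>)) = (CLINT \<omega>|M. (CLBINT t. ?f t \<omega>))"
    using P.Fubini_integral[OF int] by simp
  also have "\<dots> = (CLINT \<omega>|M. complex_of_real (2 * pi / h * indicator {\<omega> \<in> space M. Y \<omega> = x} \<omega>))"
  proof (rule integral_cong_AE)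
    show "AE \<omega> in M. (CLBINT t. ?f t \<omega>) = complex_of_real (2 * pi / h * indicator {\<omega> \<in> space M. Y \<omega> = x} \<omega>)"
      using lat AE_space
    proof eventually_elim
      case (elim \<omega>)
      then obtain k :: int where k: "Y \<omega> = of_int k * h + x" by blast
      have "(CLBINT t. ?f t \<omega>) = (if k = 0 then 2 * pi / h else 0)"
        using integral_iexp_multiple[OF h, of k] k by (simp add: set_lebesgue_integral_def)
      then show ?case using k elim h by (auto simp: indicator_def)
    qed
  qed measurable
  also have "\<dots> = complex_of_real (2 * pi / h * prob {\<omega> \<in> space M. Y \<omega> = x})"
    unfolding integral_complex_of_real by simp
  finally show ?thesis using h by simp
qed

text \<open>Applied with \<open>c\<close> proportional to a number \<open>m\<close> of steps, the
  moment of order 0 yields the decay \<open>1 / sqrt m\<close> of point probabilities, and that of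
  order 1 the decay \<open>1 / m\<close> of their differences.\<close>

lemma gaussian_abs_moments:
  fixes c :: real
  assumes "c > 0"
  shows "has_bochner_integral lborel (\<lambda>t. exp (- (c * t\<^sup>2))) (sqrt (pi / c))"
    and "has_bochner_integral lborel (\<lambda>t. exp (- (c * t\<^sup>2)) * \<bar>t\<bar>) (1 / c)"
proof -
  \<comment> \<open>The standard deviation of the normal density proportional to
    \<open>exp (- (c * t\<^sup>2))\<close>.\<close>
  define s where "s = 1 / sqrt (2 * c)"
  have s: "s > 0" "s\<^sup>2 = 1 / (2 * c)" using assms by (auto simp: s_def power_divide)
  have c: "c = 1 / (2 * s\<^sup>2)" using assms s by (simp add: field_simps)
  have e: "sqrt (pi / c) * normal_density 0 s t = exp (- (c * t\<^sup>2))" for t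
    using s(1) unfolding normal_density_def c by (simp add: ac_simps)
  show "has_bochner_integral lborel (\<lambda>t. exp (- (c * t\<^sup>2))) (sqrt (pi / c))"
    using has_bochner_integral_mult_right[OF normal_moment_even[of s 0 0, OF s(1)], of "sqrt (pi/c)"]
    by (simp add: e mult.assoc[symmetric])
  have "sqrt (pi / c) * sqrt (2 / pi) * s = 1 / c"
    using assms by (simp add: s_def real_sqrt_divide real_sqrt_mult)
  then show "has_bochner_integral lborel (\<lambda>t. exp (- (c * t\<^sup>2)) * \<bar>t\<bar>) (1 / c)"
    using has_bochner_integral_mult_right[OF normal_moment_abs_odd[of s 0 0, OF s(1)], of "sqrt (pi/c)"]
    by (simp add: e mult.assoc[symmetric] mult.assoc[of _ s] mult.commute[of s])
qed


lemma norm_set_integral_le_gaussian: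
  fixes f :: "real \<Rightarrow> complex"
  assumes [measurable]: "f \<in> borel_measurable borel" "I \<in> sets borel"
    and g: "has_bochner_integral lborel g v" "\<And>t. 0 \<le> g t"
    and le: "\<And>t. t \<in> I \<Longrightarrow> norm (f t) \<le> g t"
  shows "norm (CLBINT t:I. f t) \<le> v"
proof -
  have gi: "integrable lborel g" "integral\<^sup>L lborel g = v"
    using g(1) by (auto simp: has_bochner_integral_iff)
  have b: "norm (indicator I t *\<^sub>R f t) \<le> g t" for t
    using g(2) le by (auto simp: indicator_def)
  have "norm (CLBINT t. indicator I t *\<^sub>R f t) \<le> (LBINT t. g t)"
  proof (rule Bochner_Integration.integral_norm_bound_integral)
    show "integrable lborel (\<lambda>t. indicator I t *\<^sub>R f t)"
      using gi(1) by (rule Bochner_Integration.integrable_bound) (use b g(2) in \<open>auto intro!: order_trans[OF b]\<close>)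
  qed (use gi b in auto)
  then show ?thesis using gi by (simp add: set_lebesgue_integral_def)
qed

text \<open>Equality case of the triangle inequality: after rotating by the argument \<alpha>, the
  cosine of \<open>t * Y - \<alpha>\<close> has mean 1, hence equals 1 almost surely, which puts
  \<open>t * Y - \<alpha>\<close> into the multiples of \<open>2 * pi\<close>.\<close>

lemma (in prob_space) lattice_supported_if_norm_char_eq_1:
  fixes Y :: "'a \<Rightarrow> real"
  assumes [measurable]: "Y \<in> borel_measurable M" and t: "t \<noteq> 0"
    and one: "cmod (char (distr M borel Y) t) = 1"
  shows "\<exists>c. lattice_supported M Y (2 * pi / \<bar>t\<bar>) c"
proof -
  obtain \<alpha> where \<alpha>: "char (distr M borel Y) t = iexp \<alpha>"
    using one by (metis complex_norm_eq_1_exp)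
  have int: "integrable M (\<lambda>\<omega>. iexp (t * Y \<omega> - \<alpha>))"
    by (rule integrable_const_bound[where B=1]) auto
  have "1 = char (distr M borel Y) t * iexp (- \<alpha>)"
    unfolding \<alpha> by (simp add: exp_add[symmetric])
  also have "\<dots> = (CLINT \<omega>|M. iexp (t * Y \<omega>) * iexp (- \<alpha>))"
    by (simp add: char_def integral_distr)
  also have "\<dots> = (CLINT \<omega>|M. iexp (t * Y \<omega> - \<alpha>))"
    by (simp add: exp_add[symmetric] algebra_simps)
  finally have "1 = Re (CLINT \<omega>|M. iexp (t * Y \<omega> - \<alpha>))" by (metis one_complex.simps(1))
  also have "\<dots> = expectation (\<lambda>\<omega>. Re (iexp (t * Y \<omega> - \<alpha>)))"
    by (rule integral_Re[OF int, symmetric])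
  also have "\<dots> = expectation (\<lambda>\<omega>. cos (t * Y \<omega> - \<alpha>))" by (simp add: Re_exp)
  finally have E: "expectation (\<lambda>\<omega>. cos (t * Y \<omega> - \<alpha>)) = 1" by simp
  have ci: "integrable M (\<lambda>\<omega>. cos (t * Y \<omega> - \<alpha>))"
    by (rule integrable_const_bound[where B=1]) auto
  have "expectation (\<lambda>\<omega>. 1 - cos (t * Y \<omega> - \<alpha>)) = 0"
    using E ci by (simp add: prob_space)
  then have "AE \<omega> in M. 1 - cos (t * Y \<omega> - \<alpha>) = 0"
    using ci by (subst (asm) integral_nonneg_eq_0_iff_AE) auto
  then have "AE \<omega> in M. \<exists>k::int. Y \<omega> = of_int k * (2 * pi / \<bar>t\<bar>) + \<alpha> / t"
  proof eventually_elim
    case (elim \<omega>)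
    then have "cos (t * Y \<omega> - \<alpha>) = 1" by simp
    then obtain n :: int where n: "t * Y \<omega> - \<alpha> = of_int n * 2 * pi"
      by (auto simp: cos_one_2pi_int)
    then have "Y \<omega> = of_int n * (2 * pi) / t + \<alpha> / t" using t by (simp add: field_simps)
    \<comment> \<open>The span is written with \<open>\<bar>t\<bar>\<close>, so a negative
      \<open>t\<close> flips the integer.\<close>
    then have "Y \<omega> = of_int (if t > 0 then n else -n) * (2 * pi / \<bar>t\<bar>) + \<alpha> / t" using t by auto
    then show ?case by blast
  qed
  then show ?thesis using t by (subst lattice_supported_iff) auto
qed

text \<open>Near 0 the quadratic expansion dominates its cubic error; away from 0 continuity and
  compactness keep the modulus a fixed distance below 1. Both give \<open>1 - c * t\<^sup>2\<close>,
  which is below the exponential.\<close>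

lemma (in prob_space) norm_char_le_gaussian:
  fixes Y :: "'a \<Rightarrow> real"
  defines "\<phi> \<equiv> char (distr M borel Y)"
  assumes [measurable]: "Y \<in> borel_measurable M"
    and near: "\<And>t. cmod (\<phi> t - (1 - t\<^sup>2 * \<sigma>\<^sup>2 / 2)) \<le> t\<^sup>2 / 6 * (\<bar>t\<bar> * \<rho>)"
    and \<sigma>: "\<sigma> > 0" and \<rho>: "\<rho> \<ge> 0"
    and lt: "\<And>t. t \<noteq> 0 \<Longrightarrow> \<bar>t\<bar> \<le> T \<Longrightarrow> cmod (\<phi> t) < 1"
  shows "\<exists>c>0. \<forall>t. \<bar>t\<bar> \<le> T \<longrightarrow> cmod (\<phi> t) \<le> exp (- (c * t\<^sup>2))"
proof -
  interpret D: real_distribution "distr M borel Y" by simp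
  \<comment> \<open>The bound \<open>1 / \<sigma>\<close> keeps the quadratic approximation
    positive, the other makes the cubic error at most
    \<open>t\<^sup>2 * \<sigma>\<^sup>2 / 6\<close>; the \<open>+ 1\<close> covers
    \<open>\<rho> = 0\<close>.\<close>
  define \<epsilon> where "\<epsilon> = min (1 / \<sigma>) (\<sigma>\<^sup>2 / (\<rho> + 1))"
  have \<epsilon>: "\<epsilon> > 0" using \<sigma> \<rho> by (auto simp: \<epsilon>_def)
  have small: "cmod (\<phi> t) \<le> 1 - \<sigma>\<^sup>2 / 4 * t\<^sup>2" if "\<bar>t\<bar> \<le> \<epsilon>" for t
  proof -
    have "\<bar>t\<bar> \<le> 1 / \<sigma>" using that by (simp add: \<epsilon>_def)
    then have "\<bar>t\<bar> * \<sigma> \<le> 1" using \<sigma> by (simp add: field_simps)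
    then have "(\<bar>t\<bar> * \<sigma>)\<^sup>2 \<le> 1" using \<sigma> by (simp add: power_le_one)
    then have 1: "t\<^sup>2 * \<sigma>\<^sup>2 \<le> 1" by (simp add: power_mult_distrib)
    have "\<bar>t\<bar> * (\<rho> + 1) \<le> \<sigma>\<^sup>2" using that \<rho> by (simp add: \<epsilon>_def pos_le_divide_eq)
    then have 2: "\<bar>t\<bar> * \<rho> \<le> \<sigma>\<^sup>2" by (simp add: algebra_simps)
    have "cmod (\<phi> t) \<le> cmod (complex_of_real (1 - t\<^sup>2 * \<sigma>\<^sup>2 / 2)) + cmod (\<phi> t - (1 - t\<^sup>2 * \<sigma>\<^sup>2 / 2))"
      by (metis add_diff_cancel_left' norm_triangle_sub)
    also have "cmod (complex_of_real (1 - t\<^sup>2 * \<sigma>\<^sup>2 / 2)) = 1 - t\<^sup>2 * \<sigma>\<^sup>2 / 2"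
      using 1 by (subst norm_of_real) auto
    also have "cmod (\<phi> t - (1 - t\<^sup>2 * \<sigma>\<^sup>2 / 2)) \<le> t\<^sup>2 / 6 * \<sigma>\<^sup>2"
      using near[of t] by (rule order_trans) (intro mult_left_mono 2, simp)
    also have "1 - t\<^sup>2 * \<sigma>\<^sup>2 / 2 + t\<^sup>2 / 6 * \<sigma>\<^sup>2 = 1 - \<sigma>\<^sup>2 / 3 * t\<^sup>2" by simp
    also have "\<dots> \<le> 1 - \<sigma>\<^sup>2 / 4 * t\<^sup>2" by (intro diff_left_mono mult_right_mono) auto
    finally show ?thesis by simp
  qed
  define K where "K = {-T..-\<epsilon>} \<union> {\<epsilon>..T}"
  have "\<exists>\<delta>>0. \<forall>t\<in>K. cmod (\<phi> t) \<le> 1 - \<delta>"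
  proof (cases "K = {}")
    case False
    have "compact K" by (auto simp: K_def intro!: compact_Un)
    moreover have "continuous_on K (\<lambda>t. cmod (\<phi> t))"
      unfolding \<phi>_def by (intro continuous_intros continuous_at_imp_continuous_on ballI D.isCont_char)
    ultimately obtain t0 where t0: "t0 \<in> K" "\<And>t. t \<in> K \<Longrightarrow> cmod (\<phi> t) \<le> cmod (\<phi> t0)"
      using continuous_attains_sup[of K "\<lambda>t. cmod (\<phi> t)"] False by blast
    then have "cmod (\<phi> t0) < 1" using \<epsilon> by (intro lt) (auto simp: K_def)
    then show ?thesis using t0 by (intro exI[of _ "1 - cmod (\<phi> t0)"]) auto
  qed (auto intro: exI[of _ 1])
  then obtain \<delta> where \<delta>: "\<delta> > 0" "\<And>t. t \<in> K \<Longrightarrow> cmod (\<phi> t) \<le> 1 - \<delta>" by blast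
  \<comment> \<open>The first entry serves \<open>\<bar>t\<bar> \<le> \<epsilon>\<close>, the second
    gives \<open>c * t\<^sup>2 \<le> \<delta>\<close> on \<open>K\<close>.\<close>
  define c where "c = min (\<sigma>\<^sup>2 / 4) (\<delta> / (T\<^sup>2 + 1))"
  have "c > 0" using \<sigma> \<delta> by (auto simp: c_def add_nonneg_pos)
  moreover have "cmod (\<phi> t) \<le> exp (- (c * t\<^sup>2))" if t: "\<bar>t\<bar> \<le> T" for t
  proof -
    have "cmod (\<phi> t) \<le> 1 - c * t\<^sup>2"
    proof (cases "\<bar>t\<bar> \<le> \<epsilon>")
      case True
      have "c * t\<^sup>2 \<le> \<sigma>\<^sup>2 / 4 * t\<^sup>2"
        unfolding c_def by (intro mult_right_mono min.cobounded1) simp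
      then show ?thesis using small[OF True] by linarith
    next
      case False
      then have "t \<in> K" using t by (auto simp: K_def)
      have "t\<^sup>2 \<le> T\<^sup>2 + 1" using t power_mono[OF t, of 2] by simp
      then have "c * t\<^sup>2 \<le> \<delta> / (T\<^sup>2 + 1) * (T\<^sup>2 + 1)"
        using \<delta> by (intro mult_mono) (auto simp: c_def)
      also have "\<dots> = \<delta>" by (simp add: add_nonneg_eq_0_iff)
      finally show ?thesis using \<delta>(2)[OF \<open>t \<in> K\<close>] by linarith
    qed
    also have "\<dots> \<le> exp (- (c * t\<^sup>2))" using exp_ge_add_one_self[of "- (c * t\<^sup>2)"] by simp
    finally show ?thesis .
  qed
  ultimately show ?thesis by blast
qed

lemma lattice_round_dist:
  assumes "h > 0"
  shows "\<bar>lattice_round h b n c - c * sqrt (real n)\<bar> \<le> h"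
proof -
  define y where "y = (c * sqrt (real n) - real n * b) / h"
  have "c * sqrt (real n) = y * h + real n * b" using assms by (simp add: y_def)
  then have "lattice_round h b n c - c * sqrt (real n) = (of_int \<lfloor>y\<rfloor> - y) * h"
    unfolding lattice_round_def y_def[symmetric] by (simp add: algebra_simps)
  moreover have "\<bar>of_int \<lfloor>y\<rfloor> - y\<bar> \<le> 1" by linarith
  ultimately show ?thesis using assms mult_right_mono[of "\<bar>of_int \<lfloor>y\<rfloor> - y\<bar>" 1 h] by (simp add: abs_mult)
qed

section \<open>Lattice random walks\<close>

locale lattice_walk = prob_space M for M :: "'a measure" +
  fixes X :: "nat \<Rightarrow> 'a \<Rightarrow> real" and h b \<sigma> :: real
  assumes indep: "indep_vars (\<lambda>_. borel) X {1..}"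
    and ident: "\<And>i. i \<ge> 1 \<Longrightarrow> distr M borel (X i) = distr M borel (X 1)"
    and lattice: "\<And>i. i \<ge> 1 \<Longrightarrow> lattice_valued M (X i) h b"
    and third_moment: "\<And>i. i \<ge> 1 \<Longrightarrow> integrable M (\<lambda>\<omega>. \<bar>X i \<omega>\<bar> ^ 3)"
    and mean: "\<And>i. i \<ge> 1 \<Longrightarrow> expectation (X i) = 0"
    and second_moment: "\<And>i. i \<ge> 1 \<Longrightarrow> expectation (\<lambda>\<omega>. (X i \<omega>)\<^sup>2) = \<sigma>\<^sup>2"
    and \<sigma>_pos: "\<sigma> > 0"
begin

definition \<phi> :: "real \<Rightarrow> complex" where
  "\<phi> = char (distr M borel (X 1))"

definition \<rho> :: real where
  "\<rho> = expectation (\<lambda>\<omega>. \<bar>X 1 \<omega>\<bar> ^ 3)"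

text \<open>Sums over index sets treat the walk at times \<open>j\<close> and \<open>k\<close> and
  its increment between them uniformly, as blocks over disjoint sets and their union.\<close>

definition block :: "nat set \<Rightarrow> 'a \<Rightarrow> real" where
  "block A \<omega> = (\<Sum>i\<in>A. X i \<omega>)"

lemma X_measurable: "i \<ge> 1 \<Longrightarrow> X i \<in> borel_measurable M"
  using indep by (auto simp: indep_vars_def2)

lemma X1_measurable [measurable]: "X (Suc 0) \<in> borel_measurable M"
  using X_measurable[of 1] by simp

lemma h_pos: "h > 0"
  using lattice[of 1] by (simp add: lattice_valued_def lattice_supported_def)

lemma \<rho>_nonneg: "\<rho> \<ge> 0"
  unfolding \<rho>_def by (intro integral_nonneg_AE) auto

lemma \<phi>_measurable [measurable]: "\<phi> \<in> borel_measurable borel"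
proof -
  interpret D: real_distribution "distr M borel (X 1)" by simp
  show ?thesis unfolding \<phi>_def by (rule D.char_measurable)
qed

lemma norm_\<phi>_le_1: "cmod (\<phi> t) \<le> 1"
proof -
  interpret D: real_distribution "distr M borel (X 1)" by simp
  show ?thesis unfolding \<phi>_def by (rule D.cmod_char_le_1)
qed

lemma block_measurable [measurable]: "A \<subseteq> {1..} \<Longrightarrow> block A \<in> borel_measurable M"
  unfolding block_def using X_measurable by (intro borel_measurable_sum) auto

lemma char_block:
  assumes "A \<subseteq> {1..}"
  shows "char (distr M borel (block A)) t = \<phi> t ^ card A"
proof -
  have "char (distr M borel (block A)) t = (\<Prod>i\<in>A. char (distr M borel (X i)) t)"
    unfolding block_def by (intro char_distr_sum indep_vars_subset[OF indep] assms)
  also have "\<dots> = (\<Prod>i\<in>A. \<phi> t)"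
    unfolding \<phi>_def
  proof (intro prod.cong refl)
    fix i assume "i \<in> A"
    then have "i \<ge> 1" using assms by auto
    from ident[OF this] show "char (distr M borel (X i)) t = char (distr M borel (X 1)) t"
      by (rule arg_cong[where f = "\<lambda>D. char D t"])
  qed
  finally show ?thesis unfolding prod_constant .
qed

section \<open>Fourier inversion for sums over blocks\<close>

lemma AE_block_lattice:
  assumes "finite A" "A \<subseteq> {1..}" "x = of_int n * h + real (card A) * b"
  shows "AE \<omega> in M. \<exists>k::int. block A \<omega> = of_int k * h + x"
proof -
  have "AE \<omega> in M. \<forall>i\<in>A. \<exists>k::int. X i \<omega> = of_int k * h + b"
  proof (rule AE_finite_allI[OF assms(1)])
    fix i assume "i \<in> A"
    then have i: "i \<ge> 1" using assms by auto
    show "AE \<omega> in M. \<exists>k::int. X i \<omega> = of_int k * h + b"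
      using lattice[OF i] lattice_supported_iff[OF X_measurable[OF i]] by (simp add: lattice_valued_def)
  qed
  then show ?thesis
  proof eventually_elim
    case (elim \<omega>)
    then obtain f :: "nat \<Rightarrow> int" where f: "\<And>i. i \<in> A \<Longrightarrow> X i \<omega> = of_int (f i) * h + b" by metis
    have "block A \<omega> = of_int (sum f A) * h + real (card A) * b"
      unfolding block_def using f by (simp add: sum.distrib sum_distrib_right)
    then have "block A \<omega> = of_int (sum f A - n) * h + x"
      using assms(3) by (simp add: algebra_simps)
    then show ?case by blast
  qed
qed

lemma prob_block:
  assumes "finite A" "A \<subseteq> {1..}" "x = of_int n * h + real (card A) * b"
  shows "complex_of_real (prob {\<omega> \<in> space M. block A \<omega> = x}) =
    h / (2 * pi) * (CLBINT t:{-pi/h..pi/h}. \<phi> t ^ card A * iexp (- (t * x)))"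
  using lattice_inversion[OF block_measurable[OF assms(2)] h_pos AE_block_lattice[OF assms]]
  unfolding char_block[OF assms(2)] .

section \<open>Expansion of \<phi> at 0 and its Gaussian decay\<close>

lemma \<phi>_near_quadratic: "cmod (\<phi> t - (1 - t\<^sup>2 * \<sigma>\<^sup>2 / 2)) \<le> t\<^sup>2 / 6 * expectation (\<lambda>\<omega>. min (6 * (X 1 \<omega>)\<^sup>2) (\<bar>t\<bar> * \<bar>X 1 \<omega>\<bar> ^ 3))"
  and square_integrable: "integrable M (\<lambda>\<omega>. (X 1 \<omega>)\<^sup>2)"
proof -
  \<comment> \<open>otherwise the second moment would be the junk value 0\<close>
  show sq: "integrable M (\<lambda>\<omega>. (X 1 \<omega>)\<^sup>2)"
    using second_moment[of 1] \<sigma>_pos not_integrable_integral_eq by fastforce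
  have "integrable M (X 1)"
    by (rule square_integrable_imp_integrable[OF _ sq]) simp
  then show "cmod (\<phi> t - (1 - t\<^sup>2 * \<sigma>\<^sup>2 / 2)) \<le> t\<^sup>2 / 6 * expectation (\<lambda>\<omega>. min (6 * (X 1 \<omega>)\<^sup>2) (\<bar>t\<bar> * \<bar>X 1 \<omega>\<bar> ^ 3))"
    using char_approx3'[of "X 1" "\<sigma>\<^sup>2" "distr M borel (X 1)" t] sq mean[of 1] second_moment[of 1]
    by (simp add: \<phi>_def)
qed

text \<open>Takes the third-moment branch of the minimum: the error is then of smaller order than
  \<open>t\<^sup>2\<close>, as the local analysis at 0 requires.\<close>

lemma \<phi>_near_quadratic_cubic: "cmod (\<phi> t - (1 - t\<^sup>2 * \<sigma>\<^sup>2 / 2)) \<le> t\<^sup>2 / 6 * (\<bar>t\<bar> * \<rho>)"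
proof -
  have m: "integrable M (\<lambda>\<omega>. \<bar>t\<bar> * \<bar>X 1 \<omega>\<bar> ^ 3)" using third_moment[of 1] by simp
  have "expectation (\<lambda>\<omega>. min (6 * (X 1 \<omega>)\<^sup>2) (\<bar>t\<bar> * \<bar>X 1 \<omega>\<bar> ^ 3)) \<le> expectation (\<lambda>\<omega>. \<bar>t\<bar> * \<bar>X 1 \<omega>\<bar> ^ 3)"
  proof (rule integral_mono[OF _ m])
    show "integrable M (\<lambda>\<omega>. min (6 * (X 1 \<omega>)\<^sup>2) (\<bar>t\<bar> * \<bar>X 1 \<omega>\<bar> ^ 3))"
      using square_integrable m by (intro integrable_min) auto
  qed simp
  also have "\<dots> = \<bar>t\<bar> * \<rho>" unfolding \<rho>_def by simp
  finally show ?thesis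
    by (intro order_trans[OF \<phi>_near_quadratic] mult_left_mono) auto
qed

text \<open>Takes the second-moment branch of the minimum; the factor \<open>3 / 2\<close> is
  \<open>1 / 2\<close> from the quadratic term plus 1 from the error.\<close>

lemma norm_1_minus_\<phi>: "cmod (1 - \<phi> t) \<le> 3 / 2 * (\<sigma> * t)\<^sup>2"
proof -
  have "expectation (\<lambda>\<omega>. min (6 * (X 1 \<omega>)\<^sup>2) (\<bar>t\<bar> * \<bar>X 1 \<omega>\<bar> ^ 3)) \<le> expectation (\<lambda>\<omega>. 6 * (X 1 \<omega>)\<^sup>2)"
  proof (rule integral_mono)
    show "integrable M (\<lambda>\<omega>. min (6 * (X 1 \<omega>)\<^sup>2) (\<bar>t\<bar> * \<bar>X 1 \<omega>\<bar> ^ 3))"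
      using square_integrable third_moment[of 1] by (intro integrable_min) auto
  qed (use square_integrable in auto)
  also have "\<dots> = 6 * \<sigma>\<^sup>2" using second_moment[of 1] by simp
  finally have "t\<^sup>2 / 6 * expectation (\<lambda>\<omega>. min (6 * (X 1 \<omega>)\<^sup>2) (\<bar>t\<bar> * \<bar>X 1 \<omega>\<bar> ^ 3)) \<le> t\<^sup>2 / 6 * (6 * \<sigma>\<^sup>2)"
    by (intro mult_left_mono) auto
  with \<phi>_near_quadratic[of t] have 1: "cmod (\<phi> t - (1 - t\<^sup>2 * \<sigma>\<^sup>2 / 2)) \<le> t\<^sup>2 / 6 * (6 * \<sigma>\<^sup>2)"
    by (rule order_trans)
  have "cmod (1 - \<phi> t) = cmod (complex_of_real (t\<^sup>2 * \<sigma>\<^sup>2 / 2) - (\<phi> t - (1 - t\<^sup>2 * \<sigma>\<^sup>2 / 2)))" by simp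
  also have "\<dots> \<le> cmod (complex_of_real (t\<^sup>2 * \<sigma>\<^sup>2 / 2)) + t\<^sup>2 / 6 * (6 * \<sigma>\<^sup>2)"
    by (intro order_trans[OF norm_triangle_ineq4] add_left_mono 1)
  also have "cmod (complex_of_real (t\<^sup>2 * \<sigma>\<^sup>2 / 2)) = t\<^sup>2 * \<sigma>\<^sup>2 / 2" by (subst norm_of_real) simp
  also have "t\<^sup>2 * \<sigma>\<^sup>2 / 2 + t\<^sup>2 / 6 * (6 * \<sigma>\<^sup>2) = 3 / 2 * (\<sigma> * t)\<^sup>2" by (simp add: power_mult_distrib)
  finally show ?thesis .
qed

text \<open>With \<open>u = \<sigma> * sqrt n * \<bar>t\<bar>\<close>, the modulus is at most both
  \<open>3 / 2 * u\<^sup>2\<close> and 2. The first gives \<open>2 * u\<close> for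
  \<open>u \<le> 1\<close>, the second otherwise. Linear growth in \<open>u\<close> is the source of
  \<open>sqrt j\<close> in the covariance bound.\<close>

lemma norm_1_minus_\<phi>_power: "cmod (1 - \<phi> t ^ n) \<le> 2 * \<sigma> * sqrt (real n) * \<bar>t\<bar>"
proof -
  define u where "u = \<sigma> * sqrt (real n) * \<bar>t\<bar>"
  have u: "u \<ge> 0" using \<sigma>_pos by (simp add: u_def)
  have "cmod (1 ^ n - \<phi> t ^ n) \<le> real n * cmod (1 - \<phi> t)"
    by (rule norm_power_diff) (auto intro: norm_\<phi>_le_1)
  also have "\<dots> \<le> real n * (3 / 2 * (\<sigma> * t)\<^sup>2)" by (intro mult_left_mono norm_1_minus_\<phi>) auto
  also have "\<dots> = 3 / 2 * u\<^sup>2" by (simp add: u_def power_mult_distrib)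
  finally have 1: "cmod (1 - \<phi> t ^ n) \<le> 3 / 2 * u\<^sup>2" by simp
  have "cmod (1 - \<phi> t ^ n) \<le> cmod 1 + cmod (\<phi> t ^ n)" by (rule norm_triangle_ineq4)
  also have "\<dots> \<le> 2" using norm_\<phi>_le_1[of t] by (simp add: norm_power power_le_one)
  finally have 2: "cmod (1 - \<phi> t ^ n) \<le> 2" .
  have "cmod (1 - \<phi> t ^ n) \<le> 2 * u"
  proof (cases "u \<le> 1")
    case True
    then have "u\<^sup>2 \<le> u" using u by (simp add: power2_eq_square mult_left_le)
    then show ?thesis using 1 u by linarith
  qed (use 2 in linarith)
  then show ?thesis by (simp add: u_def)
qed

text \<open>Maximality of the span enters here: modulus 1 at some \<open>t \<noteq> 0\<close> with
  \<open>\<bar>t\<bar> \<le> pi / h\<close> would put \<open>X 1\<close> on a lattice of span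
  \<open>2 * pi / \<bar>t\<bar> \<ge> 2 * h\<close>.\<close>

lemma gaussian_bound: "\<exists>c>0. \<forall>t. \<bar>t\<bar> \<le> pi / h \<longrightarrow> cmod (\<phi> t) \<le> exp (- (c * t\<^sup>2))"
  unfolding \<phi>_def
proof (rule norm_char_le_gaussian[OF X_measurable[OF order_refl] \<phi>_near_quadratic_cubic[unfolded \<phi>_def] \<sigma>_pos \<rho>_nonneg])
  fix t assume t: "t \<noteq> 0" "\<bar>t\<bar> \<le> pi / h"
  show "cmod (char (distr M borel (X 1)) t) < 1"
  proof (rule ccontr)
    assume "\<not> ?thesis"
    then have "cmod (char (distr M borel (X 1)) t) = 1" using norm_\<phi>_le_1[of t] by (simp add: \<phi>_def)
    then obtain c where "lattice_supported M (X 1) (2 * pi / \<bar>t\<bar>) c"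
      using lattice_supported_if_norm_char_eq_1[of "X 1" t] t by auto
    then have "2 * pi / \<bar>t\<bar> \<le> h" using lattice[of 1] by (auto simp: lattice_valued_def)
    moreover have "\<bar>t\<bar> * h \<le> pi" using t h_pos by (simp add: field_simps)
    ultimately show False using t pi_gt_zero by (simp add: divide_le_eq mult.commute)
  qed
qed

definition decay :: real where
  "decay = (SOME c. c > 0 \<and> (\<forall>t. \<bar>t\<bar> \<le> pi / h \<longrightarrow> cmod (\<phi> t) \<le> exp (- (c * t\<^sup>2))))"

lemma decay: "decay > 0" "\<bar>t\<bar> \<le> pi / h \<Longrightarrow> cmod (\<phi> t) \<le> exp (- (decay * t\<^sup>2))"
  using someI_ex[of "\<lambda>c. c > 0 \<and> (\<forall>t. \<bar>t\<bar> \<le> pi / h \<longrightarrow> cmod (\<phi> t) \<le> exp (- (c * t\<^sup>2)))"] gaussian_bound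
  unfolding decay_def[symmetric] by auto

lemma norm_\<phi>_power:
  assumes "\<bar>t\<bar> \<le> pi / h"
  shows "cmod (\<phi> t ^ n) \<le> exp (- (decay * real n * t\<^sup>2))"
proof -
  have "cmod (\<phi> t ^ n) \<le> exp (- (decay * t\<^sup>2)) ^ n"
    unfolding norm_power by (intro power_mono decay(2) assms) simp
  also have "\<dots> = exp (- (decay * real n * t\<^sup>2))"
    by (simp add: exp_of_nat_mult[symmetric] algebra_simps)
  finally show ?thesis .
qed

section \<open>Point probabilities of blocks\<close>

lemma prob_block_le:
  assumes "finite A" "A \<subseteq> {1..}" "x = of_int n * h + real (card A) * b" "card A \<ge> 1"
  shows "prob {\<omega> \<in> space M. block A \<omega> = x} \<le> h / (2 * pi) * sqrt (pi / decay) * (1 / sqrt (real (card A)))"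
proof -
  have "prob {\<omega> \<in> space M. block A \<omega> = x} = cmod (complex_of_real (prob {\<omega> \<in> space M. block A \<omega> = x}))" by simp
  also have "\<dots> = h / (2 * pi) * cmod (CLBINT t:{-pi/h..pi/h}. \<phi> t ^ card A * iexp (- (t * x)))"
    unfolding prob_block[OF assms(1-3)] norm_mult using h_pos by (simp add: norm_divide norm_mult)
  also have "\<dots> \<le> h / (2 * pi) * sqrt (pi / (decay * real (card A)))"
  proof (intro mult_left_mono norm_set_integral_le_gaussian[OF _ _ gaussian_abs_moments(1)])
    fix t assume "t \<in> {-pi/h..pi/h}"
    then have "\<bar>t\<bar> \<le> pi / h" by auto
    from norm_\<phi>_power[OF this, of "card A"]
    show "cmod (\<phi> t ^ card A * iexp (- (t * x))) \<le> exp (- (decay * real (card A) * t\<^sup>2))"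
      unfolding norm_mult by simp
  qed (use decay assms h_pos in auto)
  finally show ?thesis by (simp add: real_sqrt_divide real_sqrt_mult)
qed

text \<open>The two inversion integrands share the factor \<open>\<phi> t ^ card B\<close>, which is
  Gaussian small. What remains is a difference of order
  \<open>\<bar>t\<bar> * (\<bar>x\<bar> + sqrt (card A))\<close>, so the first absolute Gaussian
  moment gives the denominator \<open>card B\<close>.\<close>

lemma prob_block_diff_le:
  assumes "finite A" "A \<subseteq> {1..}" "x = of_int n * h + real (card A) * b"
    and "finite B" "B \<subseteq> {1..}" "y = of_int n' * h + real (card B) * b" "card B \<ge> 1"
    and "A \<inter> B = {}"
  shows "prob {\<omega> \<in> space M. block B \<omega> = y} - prob {\<omega> \<in> space M. block (A \<union> B) \<omega> = x + y}
    \<le> h / (2 * pi) * ((\<bar>x\<bar> + 2 * \<sigma> * sqrt (real (card A))) / (decay * real (card B)))"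
    (is "?p - ?q \<le> _")
proof -
  define D where "D = \<bar>x\<bar> + 2 * \<sigma> * sqrt (real (card A))"
  have D: "D \<ge> 0" using \<sigma>_pos by (simp add: D_def)
  have card: "card (A \<union> B) = card A + card B" using assms by (intro card_Un_disjoint)
  have xy: "x + y = of_int (n + n') * h + real (card (A \<union> B)) * b"
    using assms card by (simp add: algebra_simps)
  have si: "set_integrable lborel {-pi/h..pi/h} (\<lambda>t. \<phi> t ^ k * iexp (- (t * z)))" for k z
    unfolding set_integrable_def
  proof (rule integrableI_bounded_set[where A="{-pi/h..pi/h}" and B=1])
    show "AE t in lborel. t \<in> {-pi/h..pi/h} \<longrightarrow> norm (indicator {-pi/h..pi/h} t *\<^sub>R (\<phi> t ^ k * iexp (- (t * z)))) \<le> 1"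
      using norm_\<phi>_le_1 by (intro AE_I2) (auto simp: norm_mult norm_power power_le_one indicator_def)
  qed (auto simp: emeasure_lborel_Icc_eq)
  have "complex_of_real (?p - ?q) = h / (2 * pi) * ((CLBINT t:{-pi/h..pi/h}. \<phi> t ^ card B * iexp (- (t * y)))
     - (CLBINT t:{-pi/h..pi/h}. \<phi> t ^ card (A \<union> B) * iexp (- (t * (x + y)))))"
    using prob_block[OF assms(4-6)] prob_block[OF _ _ xy] assms by (simp add: right_diff_distrib)
  also have "\<dots> = h / (2 * pi) * (CLBINT t:{-pi/h..pi/h}. \<phi> t ^ card B * iexp (- (t * y)) - \<phi> t ^ card (A \<union> B) * iexp (- (t * (x + y))))"
    by (subst set_integral_diff(2)[OF si si]) simp
  finally have "complex_of_real (?p - ?q) = h / (2 * pi) * (CLBINT t:{-pi/h..pi/h}. \<phi> t ^ card B * iexp (- (t * y)) - \<phi> t ^ card (A \<union> B) * iexp (- (t * (x + y))))" .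
  from arg_cong[where f=cmod, OF this]
  have "\<bar>?p - ?q\<bar> = cmod (h / (2 * pi) * (CLBINT t:{-pi/h..pi/h}. \<phi> t ^ card B * iexp (- (t * y)) - \<phi> t ^ card (A \<union> B) * iexp (- (t * (x + y)))))"
    by (simp only: norm_of_real)
  also have "\<dots> = h / (2 * pi) * cmod (CLBINT t:{-pi/h..pi/h}. \<phi> t ^ card B * iexp (- (t * y)) - \<phi> t ^ card (A \<union> B) * iexp (- (t * (x + y))))"
    unfolding norm_mult using h_pos by (simp add: norm_divide norm_mult)
  also have "\<dots> \<le> h / (2 * pi) * (D * (1 / (decay * real (card B))))"
  proof (intro mult_left_mono norm_set_integral_le_gaussian[OF _ _ has_bochner_integral_mult_right[OF gaussian_abs_moments(2)]])
    fix t assume "t \<in> {-pi/h..pi/h}"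
    then have t: "\<bar>t\<bar> \<le> pi / h" by auto
    \<comment> \<open>Pulls out the common phase and inserts \<open>- 1 + 1\<close>, so that the
      shift by \<open>x\<close> and the power of \<phi> are estimated separately.\<close>
    have "\<phi> t ^ card B * iexp (- (t * y)) - \<phi> t ^ card (A \<union> B) * iexp (- (t * (x + y)))
        = \<phi> t ^ card B * iexp (- (t * (x + y))) * ((iexp (t * x) - 1) + (1 - \<phi> t ^ card A))"
    proof -
      have e: "iexp (- (t * y)) = iexp (- (t * (x + y))) * iexp (t * x)"
        unfolding exp_add[symmetric] by (simp add: algebra_simps)
      have "w * (E * F) - z * w * E = w * E * ((F - 1) + (1 - z))" for w z E F :: complex
        by (simp add: algebra_simps)
      then show ?thesis unfolding card power_add e .
    qed
    then have "cmod (\<phi> t ^ card B * iexp (- (t * y)) - \<phi> t ^ card (A \<union> B) * iexp (- (t * (x + y))))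
        = cmod (\<phi> t ^ card B) * cmod ((iexp (t * x) - 1) + (1 - \<phi> t ^ card A))"
      by (simp add: norm_mult)
    also have "\<dots> \<le> exp (- (decay * real (card B) * t\<^sup>2)) * (\<bar>t * x\<bar> + 2 * \<sigma> * sqrt (real (card A)) * \<bar>t\<bar>)"
    proof (rule mult_mono[OF norm_\<phi>_power[OF t]])
      have "cmod (iexp (t * x) - 1) \<le> \<bar>t * x\<bar>" using iexp_approx1[of "t * x" 0] by simp
      then show "cmod ((iexp (t * x) - 1) + (1 - \<phi> t ^ card A)) \<le> \<bar>t * x\<bar> + 2 * \<sigma> * sqrt (real (card A)) * \<bar>t\<bar>"
        by (rule norm_triangle_mono[OF _ norm_1_minus_\<phi>_power])
    qed simp_all
    also have "\<dots> = D * (exp (- (decay * real (card B) * t\<^sup>2)) * \<bar>t\<bar>)"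
      by (simp add: D_def algebra_simps abs_mult)
    finally show "cmod (\<phi> t ^ card B * iexp (- (t * y)) - \<phi> t ^ card (A \<union> B) * iexp (- (t * (x + y))))
       \<le> D * (exp (- (decay * real (card B) * t\<^sup>2)) * \<bar>t\<bar>)" .
  qed (use decay assms h_pos D in auto)
  finally show ?thesis by (simp add: D_def)
qed

text \<open>Given \<open>block A = x\<close>, the second event says \<open>block B = z - x\<close>,
  and sums over disjoint index sets are independent.\<close>

lemma prob_block_joint:
  assumes "finite A" "A \<subseteq> {1..}" "finite B" "B \<subseteq> {1..}" "A \<inter> B = {}"
  shows "prob ({\<omega> \<in> space M. block A \<omega> = x} \<inter> {\<omega> \<in> space M. block (A \<union> B) \<omega> = z})
    = prob {\<omega> \<in> space M. block A \<omega> = x} * prob {\<omega> \<in> space M. block B \<omega> = z - x}"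
proof -
  have "indep_var (Pi\<^sub>M A (\<lambda>_. borel)) (\<lambda>\<omega>. restrict (\<lambda>i. X i \<omega>) A) (Pi\<^sub>M B (\<lambda>_. borel)) (\<lambda>\<omega>. restrict (\<lambda>i. X i \<omega>) B)"
    using assms by (intro indep_var_restrict[OF indep]) auto
  from indep_var_compose[OF this, of "\<lambda>f. \<Sum>i\<in>A. f i" borel "\<lambda>f. \<Sum>i\<in>B. f i" borel]
  have iv: "indep_var borel (block A) borel (block B)"
    by (simp add: comp_def block_def[abs_def] cong: sum.cong)
  have "{\<omega> \<in> space M. block A \<omega> = x} \<inter> {\<omega> \<in> space M. block (A \<union> B) \<omega> = z}
     = (\<lambda>\<omega>. (block A \<omega>, block B \<omega>)) -` ({x} \<times> {z - x}) \<inter> space M"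
    using assms by (auto simp: block_def sum.union_disjoint)
  then show ?thesis
    using indep_varD[OF iv, of "{x}" "{z - x}"]
    by (simp add: vimage_def Int_def conj_commute)
qed

section \<open>The local limit theorem\<close>

lemma \<phi>_power_tendsto: "(\<lambda>k. \<phi> (u / sqrt (real k)) ^ k) \<longlonglongrightarrow> complex_of_real (exp (- ((\<sigma> * u)\<^sup>2 / 2)))"
proof -
  \<comment> \<open>\<open>z k\<close> is the quadratic approximation of
    \<open>\<phi> (u / sqrt k)\<close>. Since both bases lie in the unit disc, their
    \<open>k\<close>-th powers differ by at most \<open>k\<close> times the difference of the bases,
    which is of order \<open>1 / sqrt k\<close>.\<close>
  define z where "z k = 1 + (- ((\<sigma> * u)\<^sup>2 / 2)) / real k" for k :: nat
  have "(\<lambda>k. complex_of_real (z k ^ k)) \<longlonglongrightarrow> complex_of_real (exp (- ((\<sigma> * u)\<^sup>2 / 2)))"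
    unfolding z_def by (intro tendsto_of_real tendsto_exp_limit_sequentially)
  moreover have "(\<lambda>k. \<phi> (u / sqrt (real k)) ^ k - complex_of_real (z k ^ k)) \<longlonglongrightarrow> 0"
  proof (rule Lim_null_comparison)
    have "(\<lambda>k. r / sqrt (real k)) \<longlonglongrightarrow> 0" for r :: real by real_asymp
    then show "(\<lambda>k. u\<^sup>2 * \<bar>u\<bar> * \<rho> / 6 / sqrt (real k)) \<longlonglongrightarrow> 0" .
    \<comment> \<open>Eventually below 1, which places \<open>z k\<close> between 0 and 1.\<close>
    have "(\<lambda>k. (\<sigma> * u)\<^sup>2 / 2 / real k) \<longlonglongrightarrow> 0" by real_asymp
    then have "\<forall>\<^sub>F k in sequentially. (\<sigma> * u)\<^sup>2 / 2 / real k < 1" by (rule order_tendstoD) simp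
    then show "\<forall>\<^sub>F k in sequentially. norm (\<phi> (u / sqrt (real k)) ^ k - complex_of_real (z k ^ k)) \<le> u\<^sup>2 * \<bar>u\<bar> * \<rho> / 6 / sqrt (real k)"
      using eventually_gt_at_top[of 0]
    proof eventually_elim
      case (elim k)
      have k: "sqrt (real k) > 0" using elim by simp
      have "0 \<le> (\<sigma> * u)\<^sup>2 / 2 / real k" by simp
      then have z: "\<bar>z k\<bar> \<le> 1" using elim(1) by (simp add: z_def)
      have "cmod (\<phi> (u / sqrt (real k)) ^ k - complex_of_real (z k) ^ k) \<le> real k * cmod (\<phi> (u / sqrt (real k)) - complex_of_real (z k))"
        using z by (intro norm_power_diff norm_\<phi>_le_1) simp
      also have "\<dots> \<le> real k * ((u / sqrt (real k))\<^sup>2 / 6 * (\<bar>u / sqrt (real k)\<bar> * \<rho>))"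
      proof (rule mult_left_mono)
        have "z k = 1 - (u / sqrt (real k))\<^sup>2 * \<sigma>\<^sup>2 / 2"
          by (simp add: z_def power_divide power_mult_distrib mult.commute)
        then show "cmod (\<phi> (u / sqrt (real k)) - complex_of_real (z k)) \<le> (u / sqrt (real k))\<^sup>2 / 6 * (\<bar>u / sqrt (real k)\<bar> * \<rho>)"
          using \<phi>_near_quadratic_cubic[of "u / sqrt (real k)"] by (simp only:)
      qed simp
      also have "real k * ((u / sqrt (real k))\<^sup>2 / 6 * (\<bar>u / sqrt (real k)\<bar> * \<rho>)) = u\<^sup>2 * \<bar>u\<bar> * \<rho> / 6 / sqrt (real k)"
        using k by (simp add: power_divide)
      finally show ?case by simp
    qed
  qed
  ultimately show ?thesis by (rule Lim_transform)
qed

text \<open>The characteristic function of the standard normal law at \<open>- a\<close>, after the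
  substitution \<open>v = s * u\<close>.\<close>

lemma gaussian_fourier_integral:
  assumes "s > 0"
  shows "(CLBINT u. complex_of_real (exp (- ((s * u)\<^sup>2 / 2))) * iexp (- (u * (a * s))))
    = complex_of_real (sqrt (2 * pi) / s * exp (- (a\<^sup>2) / 2))"
proof -
  have "complex_of_real (exp (- (a\<^sup>2) / 2)) = char std_normal_distribution (- a)"
    unfolding char_std_normal_distribution by simp
  also have "\<dots> = (CLBINT v. std_normal_density v *\<^sub>R iexp (- a * v))"
    unfolding char_def by (subst integral_density) auto
  also have "\<dots> = s *\<^sub>R (CLBINT u. std_normal_density (s * u) *\<^sub>R iexp (- a * (s * u)))"
    using assms by (subst lborel_integral_real_affine[where c = s and t = 0]) auto
  also have "\<dots> = s *\<^sub>R (CLBINT u. complex_of_real (1 / sqrt (2 * pi)) * (complex_of_real (exp (- ((s * u)\<^sup>2 / 2))) * iexp (- (u * (a * s)))))"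
    unfolding std_normal_density_def by (simp add: scaleR_conv_of_real ac_simps)
  also have "\<dots> = complex_of_real (s / sqrt (2 * pi)) * (CLBINT u. complex_of_real (exp (- ((s * u)\<^sup>2 / 2))) * iexp (- (u * (a * s))))"
    by (simp add: scaleR_conv_of_real)
  finally have e: "complex_of_real (exp (- (a\<^sup>2) / 2)) = complex_of_real (s / sqrt (2 * pi)) * (CLBINT u. complex_of_real (exp (- ((s * u)\<^sup>2 / 2))) * iexp (- (u * (a * s))))" .
  have "complex_of_real (sqrt (2 * pi) / s * exp (- (a\<^sup>2) / 2)) = complex_of_real (sqrt (2 * pi) / s) * complex_of_real (s / sqrt (2 * pi)) * (CLBINT u. complex_of_real (exp (- ((s * u)\<^sup>2 / 2))) * iexp (- (u * (a * s))))"
    unfolding of_real_mult e mult.assoc ..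
  moreover have "complex_of_real (sqrt (2 * pi) / s) * complex_of_real (s / sqrt (2 * pi)) = 1"
    unfolding of_real_mult[symmetric] using assms by simp
  ultimately show ?thesis by simp
qed

text \<open>The lattice point \<open>l\<^sub>k\<close> of the covariance formula.\<close>

definition target :: "real \<Rightarrow> nat \<Rightarrow> real" where
  "target a k = lattice_round h b k (a * \<sigma>)"

definition hit :: "real \<Rightarrow> nat \<Rightarrow> 'a set" where
  "hit a k = {\<omega> \<in> space M. block {1..k} \<omega> = target a k}"

lemma hit_measurable [measurable]: "hit a k \<in> events"
proof -
  have [measurable]: "block {1..k} \<in> borel_measurable M" by (rule block_measurable) auto
  show ?thesis unfolding hit_def by measurable
qed

lemma target_eq: "\<exists>n::int. target a k = of_int n * h + real k * b"
  unfolding target_def lattice_round_def by blast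

text \<open>For \<open>k \<ge> 1\<close> the rounding error \<open>h\<close> is absorbed into
  \<open>h * sqrt k\<close>, giving the same order \<open>sqrt k\<close> as the contribution of
  \<phi> in \<open>prob_block_diff_le\<close>.\<close>

lemma target_le:
  assumes "k \<ge> 1"
  shows "\<bar>target a k\<bar> \<le> (\<bar>a * \<sigma>\<bar> + h) * sqrt (real k)"
proof -
  have "\<bar>target a k - a * \<sigma> * sqrt (real k)\<bar> \<le> h"
    unfolding target_def by (rule lattice_round_dist[OF h_pos])
  moreover have "\<bar>a * \<sigma> * sqrt (real k)\<bar> = \<bar>a * \<sigma>\<bar> * sqrt (real k)" by (simp add: abs_mult)
  moreover have "h \<le> h * sqrt (real k)" using h_pos assms by simp
  ultimately show ?thesis by (simp add: distrib_right)
qed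

lemma target_tendsto: "(\<lambda>k. target a k / sqrt (real k)) \<longlonglongrightarrow> a * \<sigma>"
proof -
  have "(\<lambda>k. target a k / sqrt (real k) - a * \<sigma>) \<longlonglongrightarrow> 0"
  proof (rule Lim_null_comparison)
    show "(\<lambda>k. h / sqrt (real k)) \<longlonglongrightarrow> 0" by real_asymp
    show "\<forall>\<^sub>F k in sequentially. norm (target a k / sqrt (real k) - a * \<sigma>) \<le> h / sqrt (real k)"
      using eventually_gt_at_top[of 0]
    proof eventually_elim
      case (elim k)
      then have "target a k / sqrt (real k) - a * \<sigma> = (target a k - a * \<sigma> * sqrt (real k)) / sqrt (real k)"
        by (simp add: diff_divide_distrib)
      then show ?case
        using lattice_round_dist[OF h_pos, of b k "a * \<sigma>"] elim
        by (simp add: target_def divide_right_mono)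
    qed
  qed
  then show ?thesis by (simp add: LIM_zero_iff)
qed

text \<open>Substituting \<open>t = u / sqrt k\<close> in the inversion formula produces the factor
  \<open>1 / sqrt k\<close>. The integrands then converge to a Gaussian times a phase and are
  dominated by \<open>exp (- (decay * u\<^sup>2))\<close>.\<close>

lemma local_limit: "(\<lambda>k. sqrt (real k) * prob (hit a k)) \<longlonglongrightarrow> h / (sqrt (2 * pi) * \<sigma>) * exp (- (a\<^sup>2) / 2)"
proof -
  let ?I = "{-pi/h..pi/h}"
  define F where "F k u = indicator ?I (u / sqrt (real k)) *\<^sub>R (\<phi> (u / sqrt (real k)) ^ k * iexp (- (u / sqrt (real k) * target a k)))" for k u
  define G where "G u = complex_of_real (exp (- ((\<sigma> * u)\<^sup>2 / 2))) * iexp (- (u * (a * \<sigma>)))" for u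
  have eq: "complex_of_real (sqrt (real k) * prob (hit a k)) = h / (2 * pi) * (CLBINT u. F k u)" if k: "k \<ge> 1" for k
  proof -
    obtain n :: int where n: "target a k = of_int n * h + real (card {1..k}) * b" using target_eq by auto
    have "complex_of_real (prob (hit a k)) = h / (2 * pi) * (CLBINT t:?I. \<phi> t ^ card {1..k} * iexp (- (t * target a k)))"
      unfolding hit_def by (rule prob_block[OF _ _ n]) auto
    also have "(CLBINT t:?I. \<phi> t ^ card {1..k} * iexp (- (t * target a k))) = (1 / sqrt (real k)) *\<^sub>R (CLBINT u. F k u)"
      unfolding set_lebesgue_integral_def F_def
      using k by (subst lborel_integral_real_affine[where c = "1 / sqrt (real k)" and t = 0]) auto
    finally show ?thesis using k by (simp add: scaleR_conv_of_real)
  qed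
  \<comment> \<open>The index is shifted because \<open>F 0\<close>, where \<open>u / sqrt 0 = 0\<close>, is not dominated.\<close>
  have "(\<lambda>k. CLBINT u. F (Suc k) u) \<longlonglongrightarrow> (CLBINT u. G u)"
  proof (rule integral_dominated_convergence)
    show "integrable lborel (\<lambda>u. exp (- (decay * u\<^sup>2)))"
      using gaussian_abs_moments(1)[OF decay(1)] by (auto simp: has_bochner_integral_iff)
    show "AE u in lborel. norm (F (Suc m) u) \<le> exp (- (decay * u\<^sup>2))" for m
    proof (rule AE_I2)
      fix u
      define k where "k = Suc m"
      have "norm (F k u) \<le> exp (- (decay * u\<^sup>2))"
      proof (cases "u / sqrt (real k) \<in> ?I")
        case True
        then have "\<bar>u / sqrt (real k)\<bar> \<le> pi / h" by auto
        then have "cmod (\<phi> (u / sqrt (real k)) ^ k) \<le> exp (- (decay * real k * (u / sqrt (real k))\<^sup>2))"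
          by (rule norm_\<phi>_power)
        also have "decay * real k * (u / sqrt (real k))\<^sup>2 = decay * u\<^sup>2" by (simp add: power_divide k_def)
        finally show ?thesis using True by (simp add: F_def norm_mult)
      next
        case False
        then have "F k u = 0" unfolding F_def by simp
        then show ?thesis by simp
      qed
      then show "norm (F (Suc m) u) \<le> exp (- (decay * u\<^sup>2))" unfolding k_def .
    qed
    show "AE u in lborel. (\<lambda>k. F (Suc k) u) \<longlonglongrightarrow> G u"
    proof (intro AE_I2 LIMSEQ_Suc)
      fix u
      have "(\<lambda>k. \<phi> (u / sqrt (real k)) ^ k * iexp (- (u * (target a k / sqrt (real k))))) \<longlonglongrightarrow> G u"
        unfolding G_def by (intro tendsto_intros \<phi>_power_tendsto target_tendsto)
      \<comment> \<open>For fixed \<open>u\<close> the rescaled argument eventually lies in the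
        period interval, so the indicator in \<open>F\<close> becomes 1.\<close>
      moreover have "\<forall>\<^sub>F k in sequentially. \<phi> (u / sqrt (real k)) ^ k * iexp (- (u * (target a k / sqrt (real k)))) = F k u"
      proof -
        have "(\<lambda>k. \<bar>u\<bar> / sqrt (real k)) \<longlonglongrightarrow> 0" by real_asymp
        then have "\<forall>\<^sub>F k in sequentially. \<bar>u\<bar> / sqrt (real k) < pi / h"
          by (rule order_tendstoD) (use h_pos in simp)
        then show ?thesis
        proof eventually_elim
          case (elim k)
          then have "\<bar>u / sqrt (real k)\<bar> < pi / h" by simp
          then have "u / sqrt (real k) \<in> ?I" unfolding abs_less_iff by auto
          then show ?case by (simp add: F_def)
        qed
      qed
      ultimately show "(\<lambda>k. F k u) \<longlonglongrightarrow> G u" by (rule Lim_transform_eventually)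
    qed
  qed (unfold F_def G_def, measurable)
  then have lim: "(\<lambda>k. CLBINT u. F k u) \<longlonglongrightarrow> (CLBINT u. G u)" by (rule LIMSEQ_imp_Suc)
  have "(\<lambda>k. h / (2 * pi) * (CLBINT u. F k u)) \<longlonglongrightarrow> h / (2 * pi) * (CLBINT u. G u)"
    by (intro tendsto_intros lim)
  then have "(\<lambda>k. complex_of_real (sqrt (real k) * prob (hit a k))) \<longlonglongrightarrow> h / (2 * pi) * (CLBINT u. G u)"
    by (rule Lim_transform_eventually) (rule eventually_mono[OF eventually_ge_at_top[of 1]], rule eq[symmetric])
  also have "h / (2 * pi) * (CLBINT u. G u) = complex_of_real (h / (2 * pi) * (sqrt (2 * pi) / \<sigma> * exp (- (a\<^sup>2) / 2)))"
    unfolding G_def gaussian_fourier_integral[OF \<sigma>_pos] of_real_mult[symmetric] ..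
  also have "h / (2 * pi) * (sqrt (2 * pi) / \<sigma> * exp (- (a\<^sup>2) / 2)) = h / (sqrt (2 * pi) * \<sigma>) * exp (- (a\<^sup>2) / 2)"
  proof -
    have "sqrt (2 * pi) / (2 * pi) = 1 / sqrt (2 * pi)"
      by (simp add: real_div_sqrt field_simps)
    moreover have "h / (2 * pi) * (sqrt (2 * pi) / \<sigma> * exp (- (a\<^sup>2) / 2)) = sqrt (2 * pi) / (2 * pi) * (h / \<sigma> * exp (- (a\<^sup>2) / 2))"
      by (simp add: ac_simps)
    ultimately show ?thesis by simp
  qed
  finally show ?thesis unfolding tendsto_of_real_iff .
qed

section \<open>Covariances of hits and the variance of the weighted sum\<close>

definition hit_const :: real where
  "hit_const = h / (2 * pi) * sqrt (pi / decay)"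

text \<open>The maximum lets one constant serve both branches of the covariance bound:
  \<open>hit_const\<close> comes from \<open>prob_block_le\<close>, the other entry from
  \<open>prob_block_diff_le\<close> with \<open>target_le\<close> inserted.\<close>

definition cov_const :: "real \<Rightarrow> real" where
  "cov_const a = max hit_const (h / (2 * pi) * ((\<bar>a * \<sigma>\<bar> + h + 2 * \<sigma>) / decay))"

lemma hit_const_nonneg: "hit_const \<ge> 0"
  using h_pos decay(1) by (simp add: hit_const_def)

text \<open>Independence factors out \<open>prob (hit a j)\<close>, bounded by
  \<open>prob_block_le\<close>. The remaining difference compares the increment over
  \<open>m\<close> steps with the walk at time \<open>j + m\<close>. An upper bound suffices, since
  the weights are nonnegative and the variance is bounded from above.\<close>

lemma hit_covariance_le:
  fixes a :: real
  assumes j: "j \<ge> 1" and m: "m \<ge> 1"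
  defines "C \<equiv> cov_const a"
  shows "prob (hit a j \<inter> hit a (j + m)) - prob (hit a j) * prob (hit a (j + m))
    \<le> hit_const / sqrt (real j) * (C * min (1 / sqrt (real m)) (sqrt (real j) / real m))"
proof -
  define A B where "A = {1..j}" and "B = {j+1..j+m}"
  have AB: "finite A" "A \<subseteq> {1..}" "finite B" "B \<subseteq> {1..}" "A \<inter> B = {}" "card A = j" "card B = m" "A \<union> B = {1..j+m}"
    unfolding A_def B_def by auto
  obtain n1 :: int where n1: "target a j = of_int n1 * h + real (card A) * b"
    using target_eq[of a j] AB by auto
  obtain n2 :: int where n2: "target a (j + m) = of_int n2 * h + real (j + m) * b"
    using target_eq[of a "j + m"] by auto
  have n3: "target a (j + m) - target a j = of_int (n2 - n1) * h + real (card B) * b"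
    using n1 n2 AB by (simp add: algebra_simps)
  define q where "q = prob {\<omega> \<in> space M. block B \<omega> = target a (j + m) - target a j}"
  have joint: "prob (hit a j \<inter> hit a (j + m)) = prob (hit a j) * q"
    using prob_block_joint[OF AB(1-5), of "target a j" "target a (j + m)"]
    unfolding hit_def q_def AB(8) by (simp add: A_def)
  have pj: "prob (hit a j) \<le> hit_const / sqrt (real j)"
    using prob_block_le[OF AB(1,2) n1] j AB unfolding hit_def hit_const_def by (simp add: A_def)
  have q1: "q \<le> hit_const * (1 / sqrt (real m))"
    using prob_block_le[OF AB(3,4) n3] m AB unfolding q_def hit_const_def by simp
  have "q - prob (hit a (j + m)) \<le> h / (2 * pi) * ((\<bar>target a j\<bar> + 2 * \<sigma> * sqrt (real j)) / (decay * real m))"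
    using prob_block_diff_le[OF AB(1,2) n1 AB(3,4) n3 _ AB(5)] m AB unfolding hit_def q_def by simp
  also have "\<dots> \<le> h / (2 * pi) * (((\<bar>a * \<sigma>\<bar> + h + 2 * \<sigma>) * sqrt (real j)) / (decay * real m))"
    using h_pos decay(1) target_le[OF j, of a]
    by (intro mult_left_mono divide_right_mono) (auto simp: distrib_right)
  also have "\<dots> = h / (2 * pi) * ((\<bar>a * \<sigma>\<bar> + h + 2 * \<sigma>) / decay) * (sqrt (real j) / real m)" by simp
  also have "\<dots> \<le> C * (sqrt (real j) / real m)"
    by (intro mult_right_mono) (auto simp: C_def cov_const_def)
  finally have d2: "q - prob (hit a (j + m)) \<le> C * (sqrt (real j) / real m)" .
  \<comment> \<open>First branch of the minimum: the subtracted probability is dropped.\<close>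
  have "hit_const * (1 / sqrt (real m)) \<le> C * (1 / sqrt (real m))"
    by (intro mult_right_mono) (auto simp: C_def cov_const_def)
  then have d1: "q - prob (hit a (j + m)) \<le> C * (1 / sqrt (real m))"
    using q1 measure_nonneg[of M "hit a (j + m)"] by linarith
  have C: "C \<ge> 0" using hit_const_nonneg by (auto simp: C_def cov_const_def)
  have d: "q - prob (hit a (j + m)) \<le> C * min (1 / sqrt (real m)) (sqrt (real j) / real m)"
    using d1 d2 by (auto simp: min_def)
  have "prob (hit a j \<inter> hit a (j + m)) - prob (hit a j) * prob (hit a (j + m)) = prob (hit a j) * (q - prob (hit a (j + m)))"
    unfolding joint by (simp add: right_diff_distrib)
  also have "\<dots> \<le> prob (hit a j) * (C * min (1 / sqrt (real m)) (sqrt (real j) / real m))"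
    by (intro mult_left_mono d) simp
  also have "\<dots> \<le> hit_const / sqrt (real j) * (C * min (1 / sqrt (real m)) (sqrt (real j) / real m))"
    using C by (intro mult_right_mono pj) auto
  finally show ?thesis .
qed

definition hit_sum :: "real \<Rightarrow> nat \<Rightarrow> 'a \<Rightarrow> real" where
  "hit_sum a n \<omega> = (\<Sum>k=1..n. indicator (hit a k) \<omega> * (1 / sqrt (real k)))"

lemma hit_sum_measurable [measurable]: "hit_sum a n \<in> borel_measurable M"
  unfolding hit_sum_def by measurable

lemma expectation_hit_sum: "expectation (hit_sum a n) = (\<Sum>k=1..n. prob (hit a k) * (1 / sqrt (real k)))"
  unfolding hit_sum_def by (subst Bochner_Integration.integral_sum) (auto intro!: integrable_real_indicator simp: emeasure_eq_measure)

lemma hit_sum_square: "(hit_sum a n \<omega>)\<^sup>2 = (\<Sum>j=1..n. \<Sum>k=1..n. indicator (hit a j \<inter> hit a k) \<omega> * (1 / sqrt (real j) * (1 / sqrt (real k))))"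
  unfolding hit_sum_def power2_eq_square sum_product by (intro sum.cong refl) (simp add: indicator_inter_arith)

lemma integrable_hit_sum_square: "integrable M (\<lambda>\<omega>. (hit_sum a n \<omega>)\<^sup>2)"
  unfolding hit_sum_square by (intro Bochner_Integration.integrable_sum integrable_mult_left integrable_real_indicator) (auto simp: emeasure_eq_measure)

text \<open>For each \<open>j\<close> the diagonal term and the sum over all later times are both of
  order \<open>1 / j\<close>, so the total is of order \<open>harm n\<close>.\<close>

lemma variance_hit_sum_le:
  assumes n: "n \<ge> 1"
  shows "variance (hit_sum a n) \<le> (1 + 8 * (hit_const * cov_const a)) * (ln (real n) + 1)"
proof -
  define C where "C = cov_const a"
  define f where "f j k = 1 / sqrt (real j) * (1 / sqrt (real k)) * (prob (hit a j \<inter> hit a k) - prob (hit a j) * prob (hit a k))" for j k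
  have C: "C \<ge> 0" using hit_const_nonneg by (auto simp: C_def cov_const_def)
  have int: "integrable M (hit_sum a n)"
    by (rule square_integrable_imp_integrable[OF _ integrable_hit_sum_square]) simp
  have "variance (hit_sum a n) = expectation (\<lambda>\<omega>. (hit_sum a n \<omega>)\<^sup>2) - (expectation (hit_sum a n))\<^sup>2"
    by (rule variance_eq[OF int integrable_hit_sum_square])
  also have "expectation (\<lambda>\<omega>. (hit_sum a n \<omega>)\<^sup>2) = (\<Sum>j=1..n. \<Sum>k=1..n. prob (hit a j \<inter> hit a k) * (1 / sqrt (real j) * (1 / sqrt (real k))))"
    unfolding hit_sum_square
    by (subst Bochner_Integration.integral_sum, (intro Bochner_Integration.integrable_sum integrable_mult_left integrable_real_indicator; simp add: emeasure_eq_measure),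
        intro sum.cong refl, subst Bochner_Integration.integral_sum)
       (auto intro!: integrable_mult_left integrable_real_indicator simp: emeasure_eq_measure)
  also have "(expectation (hit_sum a n))\<^sup>2 = (\<Sum>j=1..n. \<Sum>k=1..n. prob (hit a j) * (1 / sqrt (real j)) * (prob (hit a k) * (1 / sqrt (real k))))"
    unfolding expectation_hit_sum power2_eq_square sum_product ..
  also have "(\<Sum>j=1..n. \<Sum>k=1..n. prob (hit a j \<inter> hit a k) * (1 / sqrt (real j) * (1 / sqrt (real k))))
      - (\<Sum>j=1..n. \<Sum>k=1..n. prob (hit a j) * (1 / sqrt (real j)) * (prob (hit a k) * (1 / sqrt (real k))))
      = (\<Sum>j=1..n. \<Sum>k=1..n. f j k)"
    unfolding sum_subtractf[symmetric] f_def by (intro sum.cong refl) (simp add: algebra_simps)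
  also have "\<dots> = (\<Sum>j=1..n. f j j + 2 * (\<Sum>m=1..n-j. f j (j + m)))"
    by (rule sum_symmetric_square) (simp add: f_def Int_commute mult.commute)
  \<comment> \<open>One factor \<open>1 / sqrt j\<close> is the weight, the other bounds the hit
    probability at \<open>j\<close>. The 4 is the kernel sum; with the factor 2 from symmetry it
    makes the final 8.\<close>
  also have "\<dots> \<le> (\<Sum>j=1..n. inverse (real j) + 2 * (hit_const * C * inverse (real j) * 4))"
  proof (intro sum_mono add_mono mult_left_mono)
    fix j assume j: "j \<in> {1..n}"
    have "prob (hit a j) - prob (hit a j) * prob (hit a j) \<le> 1"
      using prob_le_1[of "hit a j"] zero_le_square[of "prob (hit a j)"] by linarith
    then have "inverse (real j) * (prob (hit a j) - prob (hit a j) * prob (hit a j)) \<le> inverse (real j) * 1"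
      by (intro mult_left_mono) auto
    moreover have "1 / sqrt (real j) * (1 / sqrt (real j)) = inverse (real j)"
      by (simp add: divide_inverse flip: inverse_mult_distrib)
    ultimately show "f j j \<le> inverse (real j)" by (simp add: f_def)
    have "(\<Sum>m=1..n-j. f j (j + m)) \<le> (\<Sum>m=1..n-j. hit_const * C * inverse (real j) * (1 / sqrt (real (j + m)) * min (1 / sqrt (real m)) (sqrt (real j) / real m)))"
    proof (rule sum_mono)
      fix m assume m: "m \<in> {1..n-j}"
      have "f j (j + m) \<le> 1 / sqrt (real j) * (1 / sqrt (real (j + m))) * (hit_const / sqrt (real j) * (C * min (1 / sqrt (real m)) (sqrt (real j) / real m)))"
        unfolding f_def C_def using j m by (intro mult_left_mono hit_covariance_le) auto
      also have "\<dots> = hit_const * C * (1 / (sqrt (real j) * sqrt (real j))) * (1 / sqrt (real (j + m)) * min (1 / sqrt (real m)) (sqrt (real j) / real m))"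
        by (simp only: times_divide_eq_left times_divide_eq_right divide_divide_eq_left mult_1_left mult_1_right ac_simps)
      also have "1 / (sqrt (real j) * sqrt (real j)) = inverse (real j)"
        by (simp add: divide_inverse)
      finally show "f j (j + m) \<le> hit_const * C * inverse (real j) * (1 / sqrt (real (j + m)) * min (1 / sqrt (real m)) (sqrt (real j) / real m))" .
    qed
    also have "\<dots> \<le> hit_const * C * inverse (real j) * 4"
      unfolding sum_distrib_left[symmetric]
      using j C hit_const_nonneg by (intro mult_left_mono sum_covariance_kernel_le) auto
    finally show "(\<Sum>m=1..n-j. f j (j + m)) \<le> hit_const * C * inverse (real j) * 4" .
  qed simp
  also have "\<dots> = (1 + 8 * (hit_const * C)) * harm n"
    unfolding harm_def sum_distrib_left by (intro sum.cong refl) (simp add: algebra_simps)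
  also have "\<dots> \<le> (1 + 8 * (hit_const * C)) * (ln (real n) + 1)"
    using C hit_const_nonneg by (intro mult_left_mono harm_le_ln n) auto
  finally show ?thesis unfolding C_def .
qed

lemma AE_log_average:
  "AE \<omega> in M. (\<lambda>n. hit_sum a n \<omega> / ln (real n)) \<longlonglongrightarrow> h / (sqrt (2 * pi) * \<sigma>) * exp (- (a\<^sup>2) / 2)"
proof (rule AE_log_law)
  show "mono (\<lambda>n. hit_sum a n \<omega>)" for \<omega>
    unfolding hit_sum_def by (intro monoI sum_mono2) auto
  show "hit_sum a n \<omega> \<ge> 0" for n \<omega>
    unfolding hit_sum_def by (intro sum_nonneg) auto
  \<comment> \<open>The weight \<open>1 / sqrt k\<close> turns the mean into a logarithmic average
    of the sequence from \<open>local_limit\<close>.\<close>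
  have "prob (hit a k) * (1 / sqrt (real k)) = sqrt (real k) * prob (hit a k) / real k" for k
    by (cases "k = 0") (simp_all add: field_simps)
  then show "(\<lambda>n. expectation (hit_sum a n) / ln (real n)) \<longlonglongrightarrow> h / (sqrt (2 * pi) * \<sigma>) * exp (- (a\<^sup>2) / 2)"
    unfolding expectation_hit_sum using log_average_tendsto[OF local_limit] by simp
qed (use integrable_hit_sum_square variance_hit_sum_le in auto)

end

theorem corollary2:
  fixes M :: "'a measure"
    and X :: "nat \<Rightarrow> 'a \<Rightarrow> real"
    and h b \<sigma> a :: real
  assumes "prob_space M"
    and indep: "prob_space.indep_vars M (\<lambda>_. borel) X {1..}"
    and ident: "\<And>i. i \<ge> 1 \<Longrightarrow> distr M borel (X i) = distr M borel (X 1)"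
    and lattice: "\<And>i. i \<ge> 1 \<Longrightarrow> lattice_valued M (X i) h b"
    and third_moment: "\<And>i. i \<ge> 1 \<Longrightarrow> integrable M (\<lambda>\<omega>. \<bar>X i \<omega>\<bar> ^ 3)"
    and mean: "\<And>i. i \<ge> 1 \<Longrightarrow> (\<integral>\<omega>. X i \<omega> \<partial>M) = 0"
    and variance: "\<And>i. i \<ge> 1 \<Longrightarrow> (\<integral>\<omega>. (X i \<omega>)\<^sup>2 \<partial>M) = \<sigma>\<^sup>2"
    and "\<sigma> > 0"
  shows "AE \<omega> in M.
    (\<lambda>n. 1 / ln (real n) *
       (\<Sum>k=1..n. indicator {\<omega> \<in> space M. partial_sum X k \<omega> = lattice_round h b k (a * \<sigma>)} \<omega>
                    * (1 / sqrt (real k))))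
    \<longlonglongrightarrow> h / (sqrt (2 * pi) * \<sigma>) * exp (- (a\<^sup>2) / 2)"
proof -
  interpret prob_space M by fact
  interpret lattice_walk M X h b \<sigma>
    by unfold_locales (fact assms)+
  have "hit a k = {\<omega> \<in> space M. partial_sum X k \<omega> = lattice_round h b k (a * \<sigma>)}" for k
    unfolding hit_def block_def target_def partial_sum_def ..
  then show ?thesis
    using AE_log_average[of a] by (simp add: hit_sum_def)
qed

end
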